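(* Let $G=(V,E)$ be a Birkhoff von Neumann brick and let $e\in E$. Consider the conditions: (a) $G-e$ is matching covered and is a near-brick; (b) there is a unique edge $e'\ne e$ such that $G-e-e'$ is bipartite and $x_e=x_{e'}$ for all $x\in PM(G)$. If the inequality $x_e\ge 0$ is facet defining for $PM(G)$, then (a) or (b) holds. Conversely, if (a) or (b) holds, then $x_e\ge 0$ is a facet defining inequality for $PM(G)$.
   Context: Graphs are finite and undirected, and parallel edges are allowed. A perfect matching is a set of edges incident with each vertex exactly once. A graph $G=(V,E)$ with $|V|$ even is matching covered if it is connected, has at least one edge, and every edge belongs to some perfect matching. For $U\subseteq V$, the cut $C=\delta(U)$ is the set of edges with exactly one endpoint in $U$; its shores are $U$ and $V\setminus U$; it is odd if both shores have odd cardinality and non-trivial if both shores have more than one vertex. The two $C$-contractions are the graphs obtained by shrinking one of the two shores into a single vertex (discarding the edges inside that shore and keeping parallel edges). An odd cut is tight if every perfect matching meets it in exactly one edge. A tight cut decomposition of a matching covered graph is obtained by repeatedly replacing a graph having a non-trivial tight cut by its two contractions with respect to that cut until no graph in the list has a non-trivial tight cut; the resulting list is independent of the choices (up to edge multiplicities). Non-bipartite matching covered graphs without non-trivial tight cuts are bricks, bipartite ones are braces. A near-brick is a matching covered graph whose tight cut decomposition contains exactly one brick. $PM(G)\subseteq\mathbb{R}^E$ is the convex hull of the incidence vectors of the perfect matchings of $G$. With $\delta(v)$ the set of edges incident with $v$ and $x(F)=\sum_{f\in F}x_f$, let $P(G)=\{x\in\mathbb{R}^E_{\ge0}: x(\delta(v))=1\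 \forall v\in V\}$. A matching covered graph $G$ is Birkhoff von Neumann (BvN) if $PM(G)=P(G)$. A valid inequality is facet defining for $PM(G)$ if the face of $PM(G)$ on which it holds with equality has dimension $\dim(PM(G))-1$. $G-e$ denotes the graph obtained by deleting the edge $e$ (keeping all vertices). *)

theory Defs
  imports "HOL-Analysis.Analysis"
begin

text \<open>
  Parallel edges are distinct elements of \<open>edges\<close> with the same value under \<open>ends\<close>;
  the values of \<open>ends\<close> outside \<open>edges\<close> carry no meaning. Loops are excluded.
\<close>

record ('v, 'e) ugraph =
  verts :: "'v set"
  edges :: "'e set"
  ends :: "'e \<Rightarrow> 'v set"

definition wf_ugraph :: "('v, 'e) ugraph \<Rightarrow> bool" where
  "wf_ugraph G \<longleftrightarrow> finite (verts G) \<and> finite (edges G) \<and>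
     (\<forall>f \<in> edges G. ends G f \<subseteq> verts G \<and> card (ends G f) = 2)"

definition adjacent :: "('v, 'e) ugraph \<Rightarrow> 'v \<Rightarrow> 'v \<Rightarrow> bool" where
  "adjacent G u v \<longleftrightarrow> (\<exists>f \<in> edges G. ends G f = {u, v})"

definition connected_ugraph :: "('v, 'e) ugraph \<Rightarrow> bool" where
  "connected_ugraph G \<longleftrightarrow> (\<forall>u \<in> verts G. \<forall>v \<in> verts G. (adjacent G)\<^sup>*\<^sup>* u v)"

definition bipartite :: "('v, 'e) ugraph \<Rightarrow> bool" where
  "bipartite G \<longleftrightarrow> (\<exists>A B. A \<union> B = verts G \<and> A \<inter> B = {} \<and>
     (\<forall>f \<in> edges G. \<exists>a \<in> A. \<exists>b \<in> B. ends G f = {a, b}))"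

definition delete_edge :: "('v, 'e) ugraph \<Rightarrow> 'e \<Rightarrow> ('v, 'e) ugraph" where
  "delete_edge G f = G\<lparr>edges := edges G - {f}\<rparr>"

definition incident_edges :: "('v, 'e) ugraph \<Rightarrow> 'v \<Rightarrow> 'e set" where
  "incident_edges G v = {f \<in> edges G. v \<in> ends G f}"

definition perfect_matching :: "('v, 'e) ugraph \<Rightarrow> 'e set \<Rightarrow> bool" where
  "perfect_matching G M \<longleftrightarrow> M \<subseteq> edges G \<and> (\<forall>v \<in> verts G. \<exists>!f. f \<in> M \<and> v \<in> ends G f)"

definition matching_covered :: "('v, 'e) ugraph \<Rightarrow> bool" where
  "matching_covered G \<longleftrightarrow> wf_ugraph G \<and> even (card (verts G)) \<and> connected_ugraph G \<and>
     edges G \<noteq> {} \<and> (\<forall>f \<in> edges G. \<exists>M. perfect_matching G M \<and> f \<in> M)"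

definition cut :: "('v, 'e) ugraph \<Rightarrow> 'v set \<Rightarrow> 'e set" where
  "cut G U = {f \<in> edges G. card (ends G f \<inter> U) = 1}"

text \<open>A cut is represented by one of its shores; the other one is \<open>verts G - U\<close>.\<close>

definition tight_cut :: "('v, 'e) ugraph \<Rightarrow> 'v set \<Rightarrow> bool" where
  "tight_cut G U \<longleftrightarrow> U \<subseteq> verts G \<and> odd (card U) \<and> odd (card (verts G - U)) \<and>
     (\<forall>M. perfect_matching G M \<longrightarrow> card (M \<inter> cut G U) = 1)"

definition nontrivial_tight_cut :: "('v, 'e) ugraph \<Rightarrow> 'v set \<Rightarrow> bool" where
  "nontrivial_tight_cut G U \<longleftrightarrow> tight_cut G U \<and> card U > 1 \<and> card (verts G - U) > 1"

text \<open>
  Shrinking \<open>U\<close> to a single vertex, named by an arbitrary element of \<open>U\<close> so that the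
  vertex type does not change. Surviving edges keep their identity.
\<close>

definition contract :: "('v, 'e) ugraph \<Rightarrow> 'v set \<Rightarrow> ('v, 'e) ugraph" where
  "contract G U = (let u = (SOME u. u \<in> U) in
     \<lparr>verts = insert u (verts G - U),
      edges = {f \<in> edges G. \<not> ends G f \<subseteq> U},
      ends = (\<lambda>f. (\<lambda>v. if v \<in> U then u else v) ` ends G f)\<rparr>)"

inductive tight_cut_step :: "('v, 'e) ugraph list \<Rightarrow> ('v, 'e) ugraph list \<Rightarrow> bool" where
  "nontrivial_tight_cut H U \<Longrightarrow>
     tight_cut_step (xs @ [H] @ ys) (xs @ [contract H U, contract H (verts H - U)] @ ys)"

definition tight_cut_decomposition :: "('v, 'e) ugraph \<Rightarrow> ('v, 'e) ugraph list \<Rightarrow> bool" where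
  "tight_cut_decomposition G Gs \<longleftrightarrow> tight_cut_step\<^sup>*\<^sup>* [G] Gs \<and>
     (\<forall>H \<in> set Gs. \<nexists>U. nontrivial_tight_cut H U)"

definition brick :: "('v, 'e) ugraph \<Rightarrow> bool" where
  "brick G \<longleftrightarrow> matching_covered G \<and> \<not> bipartite G \<and> (\<nexists>U. nontrivial_tight_cut G U)"

text \<open>
  The number of bricks is the same in every tight cut decomposition of a matching covered
  graph, so it is read off from any one of them.
\<close>

definition near_brick :: "('v, 'e) ugraph \<Rightarrow> bool" where
  "near_brick G \<longleftrightarrow> matching_covered G \<and>
     (\<exists>Gs. tight_cut_decomposition G Gs \<and> length (filter brick Gs) = 1)"

text \<open>
  The space of real vectors indexed by \<open>edges G\<close> is identified with the coordinate subspace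
  of \<open>real ^ 'e\<close> of vectors vanishing outside \<open>edges G\<close>. The edge type is finite, but
  \<open>edges G\<close> may be a proper subset of it.
\<close>

definition incidence_vector :: "'e set \<Rightarrow> real ^ 'e::finite" where
  "incidence_vector M = (\<chi> f. indicator M f)"

definition PM_polytope :: "('v, 'e::finite) ugraph \<Rightarrow> (real ^ 'e) set" where
  "PM_polytope G = convex hull (incidence_vector ` {M. perfect_matching G M})"

definition P_polytope :: "('v, 'e::finite) ugraph \<Rightarrow> (real ^ 'e) set" where
  "P_polytope G = {x. (\<forall>f. f \<notin> edges G \<longrightarrow> x $ f = 0) \<and> (\<forall>f \<in> edges G. x $ f \<ge> 0) \<and>
     (\<forall>v \<in> verts G. (\<Sum>f \<in> incident_edges G v. x $ f) = 1)}"

definition BvN :: "('v, 'e::finite) ugraph \<Rightarrow> bool" where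
  "BvN G \<longleftrightarrow> matching_covered G \<and> PM_polytope G = P_polytope G"

text \<open>The inequality in question is \<open>a \<bullet> x \<ge> b\<close>.\<close>

definition facet_defining :: "'a::euclidean_space set \<Rightarrow> 'a \<Rightarrow> real \<Rightarrow> bool" where
  "facet_defining S a b \<longleftrightarrow> (\<forall>x \<in> S. a \<bullet> x \<ge> b) \<and>
     aff_dim {x \<in> S. a \<bullet> x = b} = aff_dim S - 1"

end

theory Submission
  imports Defs
begin


text \<open>
  Over a graph whose edges are all in perfect matchings and whose matching polytope is \<open>P\<close>, a linear
  functional that is constant on the perfect matchings has the form \<open>y u + y v\<close> on the edges \<open>uv\<close>,
  for some potential \<open>y\<close> on the vertices. Applied to the indicator of a tight cut, it shows that one
  of the two shores is bipartite and attached through a single colour class; contracting this shore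
  keeps the property, so by induction only one brick occurs in the decomposition. Applied to the
  difference \<open>x\<^sub>f - x\<^sub>e\<close> of two coordinates that agree on all perfect matchings of a brick, it gives
  \<open>\<bar>y\<bar> = 1 / 2\<close> everywhere; the signs of \<open>y\<close> are a bipartition of \<open>G - e - f\<close>, and \<open>f\<close> is unique.

  If \<open>x\<^sub>e \<ge> 0\<close> is a facet, an edge \<open>f\<close> that occurs only together with \<open>e\<close> satisfies \<open>x\<^sub>f = x\<^sub>e\<close>; if there
  is no such edge, \<open>G - e\<close> is matching covered. Conversely, the potentials for \<open>G - e\<close>, respectively
  \<open>G - e - f\<close>, show that a functional constant on the face is a multiple of \<open>x\<^sub>e\<close> plus a constant. In the
  second case one must see that all other edges are in perfect matchings avoiding \<open>e\<close>: if \<open>g\<close> is not, then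
  tightness arguments on sets closed under alternating paths produce a point of \<open>P\<close> with \<open>x\<^sub>g > x\<^sub>e\<close>.
\<close>

section \<open>Matchings and cuts\<close>

text \<open>No dimension is computed anywhere: the facet condition is turned into an equality of
  affine hulls, and that equality is tested with functionals that are constant on the face.
  Potentials then describe all such functionals.

  The induction over contractions does not carry the equality of the two polytopes, but only its
  consequence that indicators of tight cuts have potentials. This survives when a bipartite shore is
  shrunk: on it a potential alternates between two opposite values, and since all boundary edges
  start in one colour class, they see only one of them, which the new vertex can take.

  The difficulty of the last case is that one alternating cycle through \<open>g\<close> need not
  exist. Its absence leaves sets that are tight in the sense of Hall, and the brick property places
  the ends of \<open>e\<close> and \<open>f\<close> with respect to these sets so that detours
  through \<open>e\<close> and \<open>f\<close> become available. Using \<open>e\<close> and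
  \<open>f\<close> once each pays for two passes through \<open>g\<close>, so \<open>g\<close> still
  grows faster than \<open>e\<close>.\<close>

lemma wf_ugraph_edgeE:
  assumes "wf_ugraph G" "f \<in> edges G"
  obtains u v where "ends G f = {u, v}" "u \<noteq> v" "u \<in> verts G" "v \<in> verts G"
proof -
  have "card (ends G f) = 2" "ends G f \<subseteq> verts G"
    using assms by (auto simp: wf_ugraph_def)
  then show thesis
    using that by (auto simp: card_2_iff)
qed

lemma wf_ugraph_endsD:
  assumes "wf_ugraph G" "f \<in> edges G" "ends G f = {u, v}"
  shows "u \<noteq> v" "u \<in> verts G" "v \<in> verts G"
proof -
  have "card (ends G f) = 2" "ends G f \<subseteq> verts G"
    using assms by (auto simp: wf_ugraph_def)
  then show "u \<noteq> v" "u \<in> verts G" "v \<in> verts G"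
    using assms(3) by (auto split: if_splits)
qed

lemma card_pair_Int_eq_1:
  "u \<noteq> v \<Longrightarrow> card ({u, v} \<inter> U) = 1 \<longleftrightarrow> (u \<in> U) \<noteq> (v \<in> U)"
  by (cases "u \<in> U"; cases "v \<in> U") auto

lemma in_cut_iff:
  assumes "f \<in> edges G" "ends G f = {u, v}" "u \<noteq> v"
  shows "f \<in> cut G U \<longleftrightarrow> (u \<in> U) \<noteq> (v \<in> U)"
  using assms card_pair_Int_eq_1[OF assms(3), of U] by (simp add: cut_def)

lemma cut_Compl:
  assumes "wf_ugraph G"
  shows "cut G (verts G - U) = cut G U"
proof -
  have "f \<in> cut G (verts G - U) \<longleftrightarrow> f \<in> cut G U" if f: "f \<in> edges G" for f
  proof -
    obtain u v where "ends G f = {u, v}" "u \<noteq> v" "u \<in> verts G" "v \<in> verts G"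
      using wf_ugraph_edgeE[OF assms f] .
    then show ?thesis
      using f by (auto simp: in_cut_iff)
  qed
  then show ?thesis
    by (auto simp: cut_def)
qed

lemma tight_cut_Compl:
  assumes "wf_ugraph G" "tight_cut G U"
  shows "tight_cut G (verts G - U)"
  using assms unfolding tight_cut_def by (simp add: cut_Compl double_diff)

lemma nontrivial_tight_cut_Compl:
  assumes "wf_ugraph G" "nontrivial_tight_cut G U"
  shows "nontrivial_tight_cut G (verts G - U)"
  using assms tight_cut_Compl[of G U] unfolding nontrivial_tight_cut_def
  by (auto simp: tight_cut_def double_diff)

lemma bipartiteE:
  fixes G :: "('v, 'e) ugraph"
  assumes "bipartite G"
  obtains s :: "'v \<Rightarrow> bool" where "\<forall>f\<in>edges G. \<forall>a b. ends G f = {a, b} \<longrightarrow> s a \<noteq> s b"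
proof -
  obtain A B where AB: "A \<inter> B = {}" and e: "\<forall>f \<in> edges G. \<exists>a \<in> A. \<exists>b \<in> B. ends G f = {a, b}"
    using assms unfolding bipartite_def by blast
  have "(u \<in> A) \<noteq> (v \<in> A)" if f: "f \<in> edges G" and uv: "ends G f = {u, v}" for f u v
  proof -
    obtain a b where ab: "a \<in> A" "b \<in> B" "ends G f = {a, b}"
      using e f by blast
    then have "b \<notin> A"
      using AB by auto
    then show ?thesis
      using ab uv by (auto simp: doubleton_eq_iff)
  qed
  then show thesis
    by (intro that[of "\<lambda>v. v \<in> A"]) simp
qed

lemma bipartiteI:
  fixes G :: "('v, 'e) ugraph" and s :: "'v \<Rightarrow> bool"
  assumes wf: "wf_ugraph G"
    and s: "\<And>f a b. f \<in> edges G \<Longrightarrow> ends G f = {a, b} \<Longrightarrow> s a \<noteq> s b"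
  shows "bipartite G"
proof -
  have "\<exists>a \<in> {v \<in> verts G. s v}. \<exists>b \<in> {v \<in> verts G. \<not> s v}. ends G f = {a, b}"
    if f: "f \<in> edges G" for f
  proof -
    obtain u v where uv: "ends G f = {u, v}" "u \<noteq> v" "u \<in> verts G" "v \<in> verts G"
      using wf_ugraph_edgeE[OF wf f] .
    moreover have "s u \<noteq> s v"
      using s[OF f uv(1)] .
    ultimately show ?thesis
      by (cases "s u") (auto simp: insert_commute)
  qed
  then show ?thesis
    unfolding bipartite_def
    by (intro exI[of _ "{v \<in> verts G. s v}"] exI[of _ "{v \<in> verts G. \<not> s v}"]) auto
qed

text \<open>A perfect matching partitions the vertices into the ends of its edges, so a vertex
  weighting has the same total on every perfect matching. Later counts compare two matchings through
  a signed weighting \<open>y\<close>.\<close>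

lemma perfect_matching_sum:
  assumes G: "wf_ugraph G" and M: "perfect_matching G M"
  shows "(\<Sum>f\<in>M. sum y (ends G f)) = sum y (verts G)"
proof -
  have sub: "M \<subseteq> edges G" and ex1: "\<And>v. v \<in> verts G \<Longrightarrow> \<exists>!f. f \<in> M \<and> v \<in> ends G f"
    using M by (auto simp: perfect_matching_def)
  have ends: "ends G f \<subseteq> verts G" "finite (ends G f)" if "f \<in> M" for f
    using G sub that by (auto simp: wf_ugraph_def intro: finite_subset)
  have "finite M"
    using G sub by (auto simp: wf_ugraph_def intro: finite_subset)
  moreover have "ends G f \<inter> ends G g = {}" if fg: "f \<in> M" "g \<in> M" "f \<noteq> g" for f g
  proof (rule ccontr)
    assume "ends G f \<inter> ends G g \<noteq> {}"
    then obtain v where v: "v \<in> ends G f" "v \<in> ends G g"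
      by blast
    then have "v \<in> verts G"
      using ends(1) fg by blast
    then show False
      using ex1 v fg by blast
  qed
  moreover have "verts G \<subseteq> (\<Union>f\<in>M. ends G f)"
  proof
    fix v assume "v \<in> verts G"
    then obtain f where "f \<in> M" "v \<in> ends G f"
      using ex1 by blast
    then show "v \<in> (\<Union>f\<in>M. ends G f)"
      by blast
  qed
  then have "(\<Union>f\<in>M. ends G f) = verts G"
    using ends(1) by blast
  ultimately show ?thesis
    using ends(2) sum.UNION_disjoint[of M "ends G" y] by simp
qed

lemma perfect_matching_edge_at:
  assumes "perfect_matching G M" "v \<in> verts G"
  obtains f where "f \<in> M" "v \<in> ends G f" "f \<in> edges G"
  using assms unfolding perfect_matching_def by blast

lemma perfect_matching_unique:
  assumes "wf_ugraph G" "perfect_matching G M" "f \<in> M" "g \<in> M" "v \<in> ends G f" "v \<in> ends G g"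
  shows "f = g"
  using assms unfolding perfect_matching_def wf_ugraph_def by blast

lemma perfect_matching_sum_card:
  assumes "wf_ugraph G" "perfect_matching G M" "K \<subseteq> verts G"
  shows "(\<Sum>f\<in>M. card (ends G f \<inter> K)) = card K"
proof -
  have "card (ends G f \<inter> K) = (\<Sum>v\<in>ends G f. of_bool (v \<in> K))" if "f \<in> M" for f
  proof -
    have "f \<in> edges G"
      using assms that by (auto simp: perfect_matching_def)
    then have "finite (ends G f)"
      using assms(1) wf_ugraph_edgeE by (metis finite.simps)
    then show ?thesis
      by (simp add: sum.If_cases of_bool_def Int_def)
  qed
  then have "(\<Sum>f\<in>M. card (ends G f \<inter> K)) = (\<Sum>f\<in>M. \<Sum>v\<in>ends G f. of_bool (v \<in> K))"
    by simp
  also have "\<dots> = (\<Sum>v\<in>verts G. of_bool (v \<in> K))"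
    by (rule perfect_matching_sum[OF assms(1,2)])
  also have "\<dots> = card K"
    using assms by (simp add: of_bool_def sum.If_cases wf_ugraph_def Int_absorb1)
  finally show ?thesis .
qed

lemma even_card_if_uncut:
  assumes "wf_ugraph G" "perfect_matching G M" "K \<subseteq> verts G" "M \<inter> cut G K = {}"
  shows "even (card K)"
proof -
  have "even (card (ends G f \<inter> K))" if "f \<in> M" for f
  proof -
    have f: "f \<in> edges G"
      using assms that by (auto simp: perfect_matching_def)
    obtain u v where uv: "ends G f = {u, v}" "u \<noteq> v"
      using wf_ugraph_edgeE[OF assms(1) f] .
    then have "(u \<in> K) = (v \<in> K)"
      using assms(4) that in_cut_iff[OF f uv] by blast
    then show ?thesis
      using uv by auto
  qed
  then have "even (\<Sum>f\<in>M. card (ends G f \<inter> K))"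
    by (intro dvd_sum)
  then show ?thesis
    using perfect_matching_sum_card[OF assms(1,2,3)] by simp
qed

text \<open>Connectivity is handled through cuts because these transfer well: the cuts of a
  contraction are cuts of the original graph, and deleting an edge removes at most that edge from a
  cut.\<close>

lemma connected_ugraph_iff_cut:
  assumes "wf_ugraph G"
  shows "connected_ugraph G \<longleftrightarrow> (\<forall>K. K \<subseteq> verts G \<and> K \<noteq> {} \<and> K \<noteq> verts G \<longrightarrow> cut G K \<noteq> {})"
proof
  assume conn: "connected_ugraph G"
  show "\<forall>K. K \<subseteq> verts G \<and> K \<noteq> {} \<and> K \<noteq> verts G \<longrightarrow> cut G K \<noteq> {}"
  proof (intro allI impI)
    fix K assume K: "K \<subseteq> verts G \<and> K \<noteq> {} \<and> K \<noteq> verts G"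
    then obtain u w where u: "u \<in> K" and w: "w \<in> verts G" "w \<notin> K"
      by blast
    have "(adjacent G)\<^sup>*\<^sup>* u w"
      using conn u w K by (auto simp: connected_ugraph_def)
    then have "cut G K \<noteq> {} \<or> w \<in> K"
    proof induction
      case base
      then show ?case using u by simp
    next
      case (step a b)
      then obtain f where f: "f \<in> edges G" "ends G f = {a, b}"
        by (auto simp: adjacent_def)
      moreover have "a \<noteq> b"
        using wf_ugraph_endsD[OF assms f] by simp
      ultimately show ?case
        using step.IH in_cut_iff[of f G a b K] by auto
    qed
    then show "cut G K \<noteq> {}"
      using w by simp
  qed
next
  assume cuts: "\<forall>K. K \<subseteq> verts G \<and> K \<noteq> {} \<and> K \<noteq> verts G \<longrightarrow> cut G K \<noteq> {}"
  show "connected_ugraph G"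
    unfolding connected_ugraph_def
  proof (intro ballI)
    fix u v assume u: "u \<in> verts G" and v: "v \<in> verts G"
    define K where "K = {w \<in> verts G. (adjacent G)\<^sup>*\<^sup>* u w}"
    have "cut G K = {}"
    proof (rule ccontr)
      assume "cut G K \<noteq> {}"
      then obtain f where f: "f \<in> cut G K" by blast
      then have fe: "f \<in> edges G" by (simp add: cut_def)
      obtain a b where ab: "ends G f = {a, b}" "a \<noteq> b" "a \<in> verts G" "b \<in> verts G"
        using wf_ugraph_edgeE[OF assms fe] .
      have "adjacent G a b" "adjacent G b a"
        using ab fe by (auto simp: adjacent_def insert_commute)
      then have "a \<in> K \<longleftrightarrow> b \<in> K"
        using ab by (auto simp: K_def intro: rtranclp.rtrancl_into_rtrancl)
      then show False
        using f in_cut_iff[OF fe ab(1,2)] by blast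
    qed
    moreover have "u \<in> K" "K \<subseteq> verts G"
      using u by (auto simp: K_def)
    ultimately have "K = verts G"
      using cuts by blast
    then show "(adjacent G)\<^sup>*\<^sup>* u v"
      using v by (auto simp: K_def)
  qed
qed

lemma matching_coveredD:
  assumes "matching_covered G"
  shows "wf_ugraph G" "even (card (verts G))" "connected_ugraph G" "edges G \<noteq> {}"
    "\<And>f. f \<in> edges G \<Longrightarrow> \<exists>M. perfect_matching G M \<and> f \<in> M"
  using assms by (auto simp: matching_covered_def)

text \<open>The shores of a tight cut induce connected subgraphs.\<close>

lemma tight_cut_shore_const:
  assumes G: "matching_covered G" and U: "tight_cut G U"
    and eq: "\<And>f u v. f \<in> edges G \<Longrightarrow> ends G f = {u, v} \<Longrightarrow> u \<noteq> v \<Longrightarrow> u \<in> U \<Longrightarrow> v \<in> U \<Longrightarrow> h u = h v"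
    and uv: "u \<in> U" "v \<in> U"
  shows "h u = h v"
proof (rule ccontr)
  assume neq: "h u \<noteq> h v"
  note wf = matching_coveredD(1)[OF G]
  have UV: "U \<subseteq> verts G" and finU: "finite U"
    using U wf by (auto simp: tight_cut_def wf_ugraph_def intro: finite_subset)
  define K where "K = {w \<in> U. h w = h u}"
  define L where "L = U - K"
  have KL: "K \<union> L = U" "K \<inter> L = {}" "K \<noteq> {}" "L \<noteq> {}"
    using uv neq by (auto simp: K_def L_def)
  have cutKL: "f \<in> cut G U \<and> (f \<in> cut G K \<longleftrightarrow> f \<notin> cut G L)" if "f \<in> cut G K \<or> f \<in> cut G L" for f
  proof -
    have fe: "f \<in> edges G"
      using that by (auto simp: cut_def)
    obtain a b where ab: "ends G f = {a, b}" "a \<noteq> b" "a \<in> verts G" "b \<in> verts G"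
      using wf_ugraph_edgeE[OF wf fe] .
    then show ?thesis
      using that eq[OF fe ab(1,2)] by (auto simp: in_cut_iff[OF fe ab(1,2)] K_def L_def)
  qed
  \<comment> \<open>With no edge between the parts \<open>X\<close> and \<open>Y\<close> of
    \<open>U\<close>, an edge leaving \<open>Y\<close> leaves \<open>U\<close>. A matching through
    it must also leave the odd set \<open>X\<close>, and so meets the cut of \<open>U\<close>
    twice.\<close>
  have key: False if XY: "X \<union> Y = U" "X \<inter> Y = {}" "Y \<noteq> {}" "X \<noteq> {}" "odd (card X)"
    and sub: "cut G X \<subseteq> cut G U" "cut G Y \<subseteq> cut G U" "cut G X \<inter> cut G Y = {}" for X Y
  proof -
    have "Y \<noteq> verts G" "Y \<subseteq> verts G"
      using XY UV by auto
    then have "cut G Y \<noteq> {}"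
      using XY matching_coveredD(3)[OF G] connected_ugraph_iff_cut[OF wf] by auto
    then obtain f where f: "f \<in> cut G Y" by blast
    then obtain M where M: "perfect_matching G M" "f \<in> M"
      using matching_coveredD(5)[OF G] by (auto simp: cut_def)
    have "M \<inter> cut G X \<noteq> {}"
      using even_card_if_uncut[OF wf M(1), of X] XY UV by auto
    then obtain g where g: "g \<in> M" "g \<in> cut G X" by blast
    have "card (M \<inter> cut G U) = 1"
      using U M by (simp add: tight_cut_def)
    then obtain h where "M \<inter> cut G U = {h}"
      by (rule card_1_singletonE)
    moreover have "f \<in> M \<inter> cut G U" "g \<in> M \<inter> cut G U"
      using f g M sub by auto
    ultimately have "f = g"
      by simp
    then show False
      using f g sub by auto
  qed
  have "card K + card L = card U"
    using KL finU card_Un_disjoint[of K L] by (metis finite_Un)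
  moreover have "odd (card U)"
    using U by (simp add: tight_cut_def)
  ultimately have "odd (card K) \<or> odd (card L)"
    by presburger
  moreover have sub: "cut G K \<subseteq> cut G U" "cut G L \<subseteq> cut G U" "cut G K \<inter> cut G L = {}"
    using cutKL by auto
  moreover have "cut G L \<inter> cut G K = {}" "L \<union> K = U" "L \<inter> K = {}"
    using sub(3) KL by auto
  ultimately show False
    using key[of K L] key[of L K] KL by metis
qed


section \<open>Matching polytopes\<close>

lemma inner_incidence_vector: "a \<bullet> incidence_vector M = (\<Sum>f\<in>M. a $ f)"
  by (simp add: inner_vec_def incidence_vector_def indicator_def if_distrib sum.If_cases cong: if_cong)

lemma incidence_vector_nth [simp]: "incidence_vector M $ f = indicator M f"
  by (simp add: incidence_vector_def)

lemma incidence_vector_in_PM: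
  "perfect_matching G M \<Longrightarrow> incidence_vector M \<in> PM_polytope G"
  unfolding PM_polytope_def by (intro hull_inc) auto

lemma PM_polytope_le:
  assumes "\<And>M. perfect_matching G M \<Longrightarrow> a \<bullet> incidence_vector M \<le> b" "x \<in> PM_polytope G"
  shows "a \<bullet> x \<le> b"
proof -
  have "PM_polytope G \<subseteq> {x. a \<bullet> x \<le> b}"
    unfolding PM_polytope_def
    by (rule hull_minimal) (use assms(1) in \<open>auto simp: convex_halfspace_le\<close>)
  then show ?thesis
    using assms(2) by blast
qed

lemma PM_polytope_eq:
  assumes "\<And>M. perfect_matching G M \<Longrightarrow> a \<bullet> incidence_vector M = b" "x \<in> PM_polytope G"
  shows "a \<bullet> x = b"
proof (rule antisym)
  show "a \<bullet> x \<le> b"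
    by (rule PM_polytope_le[OF _ assms(2)]) (simp add: assms(1))
  have "(- a) \<bullet> x \<le> - b"
    by (rule PM_polytope_le[OF _ assms(2)]) (simp add: assms(1))
  then show "b \<le> a \<bullet> x"
    by simp
qed

lemma incidence_vector_in_P:
  assumes "wf_ugraph G" "perfect_matching G M"
  shows "incidence_vector M \<in> P_polytope G"
proof -
  have "(\<Sum>f\<in>incident_edges G v. indicator M f) = (1::real)" if v: "v \<in> verts G" for v
  proof -
    obtain f where f: "f \<in> M" "v \<in> ends G f" "f \<in> edges G"
      using perfect_matching_edge_at[OF assms(2) v] .
    have "incident_edges G v \<inter> M = {f}"
    proof (intro equalityI subsetI)
      fix g assume "g \<in> incident_edges G v \<inter> M"
      then have "g \<in> M" "v \<in> ends G g"
        by (simp_all add: incident_edges_def)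
      then show "g \<in> {f}"
        using perfect_matching_unique[OF assms _ f(1) _ f(2)] by simp
    qed (use f in \<open>simp add: incident_edges_def\<close>)
    moreover have "finite (incident_edges G v)"
      using assms(1) by (auto simp: wf_ugraph_def incident_edges_def)
    ultimately show ?thesis
      by (simp add: indicator_def sum.If_cases Int_def)
  qed
  moreover have "M \<subseteq> edges G"
    using assms(2) by (simp add: perfect_matching_def)
  ultimately show ?thesis
    by (auto simp: P_polytope_def indicator_def)
qed

lemma P_polytope_convex: "convex (P_polytope G)"
  unfolding convex_def P_polytope_def
  by (auto simp: sum.distrib simp flip: sum_distrib_left)

lemma PM_subset_P:
  assumes "wf_ugraph G"
  shows "PM_polytope G \<subseteq> P_polytope G"
  unfolding PM_polytope_def
  by (rule hull_minimal) (use assms in \<open>auto intro: incidence_vector_in_P P_polytope_convex\<close>)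

text \<open>The equality constraints survive any multiple of \<open>d\<close>. Among the finitely
  many sign constraints, those active at \<open>z\<close> are covered by the assumption on
  \<open>d\<close>, and the others hold for small steps by continuity.\<close>

lemma P_polytope_perturb:
  fixes z d :: "real ^ 'e::finite"
  assumes z: "z \<in> P_polytope G"
    and supp: "\<And>f. f \<notin> edges G \<Longrightarrow> d $ f = 0"
    and star: "\<And>v. v \<in> verts G \<Longrightarrow> (\<Sum>f\<in>incident_edges G v. d $ f) = 0"
    and pos: "\<And>f. f \<in> edges G \<Longrightarrow> z $ f = 0 \<Longrightarrow> d $ f \<ge> 0"
  obtains t where "t > 0" "z + t *\<^sub>R d \<in> P_polytope G"
proof -
  have "\<forall>\<^sub>F t in at_right (0::real). z $ f + t * d $ f \<ge> 0" for f
  proof (cases "z $ f = 0 \<or> f \<notin> edges G")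
    case True
    then have zf: "z $ f = 0"
      using z by (auto simp: P_polytope_def)
    then have "d $ f \<ge> 0"
      using supp[of f] pos[of f] by (cases "f \<in> edges G") auto
    then show ?thesis
      using zf by (intro eventually_mono[OF eventually_at_right_less[of 0]]) simp
  next
    case False
    then have zp: "z $ f > 0"
      using z by (auto simp: P_polytope_def less_le)
    have "((\<lambda>t. z $ f + t * d $ f) \<longlongrightarrow> z $ f + 0 * d $ f) (at_right 0)"
      by (intro tendsto_intros)
    then have "\<forall>\<^sub>F t in at_right 0. z $ f + t * d $ f > 0"
      using zp by (intro order_tendstoD(1)) auto
    then show ?thesis
      by (rule eventually_mono) simp
  qed
  then have "\<forall>\<^sub>F t in at_right (0::real). \<forall>f. z $ f + t * d $ f \<ge> 0"
    by (rule eventually_all_finite)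
  then have "\<forall>\<^sub>F t in at_right (0::real). t > 0 \<and> (\<forall>f. z $ f + t * d $ f \<ge> 0)"
    using eventually_at_right_less[of "0::real"] by eventually_elim auto
  then obtain t where t: "t > 0" "\<And>f. z $ f + t * d $ f \<ge> 0"
    using eventually_happens'[OF trivial_limit_at_right_real] by blast
  have "z + t *\<^sub>R d \<in> P_polytope G"
    using z t supp star by (auto simp: P_polytope_def sum.distrib simp flip: sum_distrib_left)
  then show thesis
    using that t by blast
qed

text \<open>The coefficients are indexed by \<open>S\<close> and not by the vectors, since
  \<open>r\<close> need not be injective: two vertices joined only to each other have the same
  star.\<close>

lemma span_imageE:
  fixes r :: "'a \<Rightarrow> 'b::real_vector"
  assumes "finite S" "x \<in> span (r ` S)"
  obtains u where "x = (\<Sum>s\<in>S. u s *\<^sub>R r s)"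
proof -
  define L where "L = range (\<lambda>u. \<Sum>s\<in>S. u s *\<^sub>R r s)"
  have "subspace L"
  proof (rule subspaceI)
    show "0 \<in> L"
      unfolding L_def by (rule range_eqI[of _ _ "\<lambda>_. 0"]) simp
  next
    fix x y assume "x \<in> L" "y \<in> L"
    then obtain u w where "x = (\<Sum>s\<in>S. u s *\<^sub>R r s)" "y = (\<Sum>s\<in>S. w s *\<^sub>R r s)"
      by (auto simp: L_def)
    then show "x + y \<in> L"
      unfolding L_def
      by (intro range_eqI[of _ _ "\<lambda>s. u s + w s"]) (simp add: scaleR_add_left sum.distrib)
  next
    fix c :: real and x assume "x \<in> L"
    then obtain u where "x = (\<Sum>s\<in>S. u s *\<^sub>R r s)"
      by (auto simp: L_def)
    then show "c *\<^sub>R x \<in> L"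
      unfolding L_def by (intro range_eqI[of _ _ "\<lambda>s. c * u s"]) (simp add: scaleR_sum_right)
  qed
  moreover have "r s \<in> L" if "s \<in> S" for s
    unfolding L_def using assms(1) that
    by (intro range_eqI[of _ _ "\<lambda>t. if t = s then 1 else 0"])
      (simp add: if_distrib[of "\<lambda>a. a *\<^sub>R _"] sum.delta cong: if_cong)
  ultimately have "span (r ` S) \<subseteq> L"
    by (intro span_minimal) auto
  then show thesis
    using assms(2) that by (auto simp: L_def)
qed

text \<open>Split \<open>c\<close> into a part \<open>p\<close> in the span of the stars and a part
  \<open>q\<close> orthogonal to them. The mean \<open>z\<close> of all perfect matchings is
  positive on every edge, so a small step from \<open>z\<close> along \<open>q\<close> stays in
  \<open>P_polytope G\<close>, where \<open>c\<close> is constant. Hence \<open>q\<close> is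
  orthogonal to \<open>c\<close> and to \<open>p\<close>, thus to itself. The assumptions are shaped
  to fit graphs with deleted edges as well, whose connectivity is not known.\<close>

lemma BvN_potential:
  fixes G :: "('v, 'e::finite) ugraph" and c :: "'e \<Rightarrow> real"
  assumes wf: "wf_ugraph G"
    and cov: "\<And>f. f \<in> edges G \<Longrightarrow> \<exists>M. perfect_matching G M \<and> f \<in> M"
    and PM: "PM_polytope G = P_polytope G"
    and c: "\<And>M. perfect_matching G M \<Longrightarrow> (\<Sum>f\<in>M. c f) = \<gamma>"
  obtains y where "\<forall>f\<in>edges G. c f = sum y (ends G f)"
proof (cases "edges G = {}")
  case True
  then show thesis
    using that by blast
next
  case False
  define MM where "MM = {M. perfect_matching G M}"
  define z where "z = (\<Sum>M\<in>MM. (1 / card MM) *\<^sub>R incidence_vector M :: real ^ 'e)"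
  have MM: "finite MM" "MM \<noteq> {}"
    using cov False by (auto simp: MM_def)
  have z: "z \<in> P_polytope G"
    unfolding z_def using MM wf
    by (intro convex_sum P_polytope_convex incidence_vector_in_P) (auto simp: MM_def)
  have zpos: "z $ f > 0" if fe: "f \<in> edges G" for f
  proof -
    obtain M where "perfect_matching G M" "f \<in> M"
      using cov[OF fe] by blast
    then have "0 < (\<Sum>M\<in>MM. (1 / card MM) * indicator M f :: real)"
      using MM by (intro sum_pos2[where i = M]) (auto simp: MM_def card_gt_0_iff)
    then show ?thesis
      by (simp add: z_def)
  qed
  define r where "r = (\<lambda>v. (\<chi> f. if f \<in> edges G \<and> v \<in> ends G f then 1 else 0) :: real ^ 'e)"
  define W where "W = span (r ` verts G)"
  \<comment> \<open>Cutting \<open>c\<close> off outside \<open>edges G\<close> keeps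
    \<open>q\<close> supported on the edges, as a direction inside the polytope must be.\<close>
  define c' where "c' = ((\<chi> f. if f \<in> edges G then c f else 0) :: real ^ 'e)"
  obtain p q where pq: "p \<in> W" "\<And>w. w \<in> W \<Longrightarrow> orthogonal q w" "c' = p + q"
    using orthogonal_subspace_decomp_exists[of "r ` verts G" c'] unfolding W_def by metis
  have star: "(\<Sum>f\<in>incident_edges G v. x $ f) = x \<bullet> r v" for v and x :: "real ^ 'e"
    by (simp add: inner_vec_def r_def incident_edges_def if_distrib sum.If_cases cong: if_cong)
  obtain u where u: "p = (\<Sum>v\<in>verts G. u v *\<^sub>R r v)"
    using span_imageE[of "verts G" p r] pq(1) wf by (auto simp: W_def wf_ugraph_def)
  have supp: "q $ f = 0" if "f \<notin> edges G" for f
  proof -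
    have "p $ f = 0"
      using that by (simp add: u r_def)
    moreover have "c' $ f = 0"
      using that by (simp add: c'_def)
    ultimately show ?thesis
      using pq(3) by simp
  qed
  have "q \<bullet> r v = 0" if "v \<in> verts G" for v
    using pq(2) that by (auto simp: W_def orthogonal_def span_base)
  then obtain t where t: "t > 0" "z + t *\<^sub>R q \<in> P_polytope G"
    using P_polytope_perturb[OF z supp] zpos star by (metis less_irrefl)
  have "c' \<bullet> x = \<gamma>" if "x \<in> P_polytope G" for x
  proof (rule PM_polytope_eq[of G])
    fix M assume M: "perfect_matching G M"
    then have "M \<subseteq> edges G"
      by (simp add: perfect_matching_def)
    then have "(\<Sum>f\<in>M. c' $ f) = (\<Sum>f\<in>M. c f)"
      by (intro sum.cong) (auto simp: c'_def)
    then show "c' \<bullet> incidence_vector M = \<gamma>"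
      using c[OF M] by (simp add: inner_incidence_vector)
  qed (use that PM in simp)
  from this[OF z] this[OF t(2)] have "c' \<bullet> q = 0"
    using t(1) by (simp add: inner_right_distrib)
  moreover have "q \<bullet> p = 0"
    using pq(1,2) by (simp add: orthogonal_def)
  ultimately have "q = 0"
    using pq(3) by (simp add: inner_add_left inner_add_right inner_commute)
  have "c f = sum u (ends G f)" if f: "f \<in> edges G" for f
  proof -
    have "ends G f \<subseteq> verts G" "finite (verts G)"
      using wf f by (auto simp: wf_ugraph_def)
    then have "{v \<in> verts G. v \<in> ends G f} = ends G f"
      by blast
    moreover have "c f = c' $ f"
      using f by (simp add: c'_def)
    then have "c f = p $ f"
      using pq(3) \<open>q = 0\<close> by simp
    ultimately show ?thesis
      using f wf by (simp add: u r_def if_distrib sum.If_cases Int_def wf_ugraph_def cong: if_cong)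
  qed
  then show thesis
    using that by blast
qed


section \<open>Facets\<close>

text \<open>The points \<open>p\<close> and \<open>q\<close> make the face non-empty and proper, so
  the hyperplane lowers the dimension of the affine hull by exactly one. Nested sets of equal
  dimension have the same affine hull.\<close>

lemma facet_defining_iff:
  fixes S :: "'a::euclidean_space set"
  assumes ge: "\<And>x. x \<in> S \<Longrightarrow> a \<bullet> x \<ge> b"
    and "p \<in> S" "a \<bullet> p = b" "q \<in> S" "a \<bullet> q \<noteq> b"
  shows "facet_defining S a b \<longleftrightarrow>
    affine hull {x \<in> S. a \<bullet> x = b} = affine hull S \<inter> {x. a \<bullet> x = b}"
proof -
  define T where "T = affine hull S \<inter> {x. a \<bullet> x = b}"
  have T: "p \<in> T" "\<not> affine hull S \<subseteq> {x. a \<bullet> x = b}"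
    using assms hull_inc[of _ S affine] by (auto simp: T_def)
  have "aff_dim T = aff_dim S - 1"
    using aff_dim_affine_Int_hyperplane[of "affine hull S" a b] T
    by (auto simp: T_def aff_dim_affine_hull split: if_splits)
  then have "facet_defining S a b \<longleftrightarrow> aff_dim {x \<in> S. a \<bullet> x = b} = aff_dim T"
    using ge by (auto simp: facet_defining_def)
  also have "{x \<in> S. a \<bullet> x = b} \<subseteq> T"
    using hull_inc[of _ S affine] by (auto simp: T_def)
  then have "aff_dim {x \<in> S. a \<bullet> x = b} = aff_dim T \<longleftrightarrow>
      affine hull {x \<in> S. a \<bullet> x = b} = affine hull T"
    by (rule aff_dim_eq_full_gen)
  also have "affine hull T = T"
    unfolding T_def affine_hull_eq by (intro affine_Int affine_affine_hull affine_hyperplane)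
  finally show ?thesis
    by (simp add: T_def)
qed

lemma affine_hull_constI:
  fixes S :: "'a::euclidean_space set"
  assumes "\<And>x. x \<in> S \<Longrightarrow> c \<bullet> x = \<gamma>" "x \<in> affine hull S"
  shows "c \<bullet> x = \<gamma>"
proof -
  have "affine hull S \<subseteq> {x. c \<bullet> x = \<gamma>}"
    by (rule hull_minimal) (use assms(1) in \<open>auto simp: affine_hyperplane\<close>)
  then show ?thesis
    using assms(2) by blast
qed

text \<open>The functional is the component of \<open>z - p\<close> orthogonal to the directions of
  the affine hull; it is non-zero because \<open>z\<close> lies outside.\<close>

lemma not_in_affine_hullE:
  fixes S :: "'a::euclidean_space set"
  assumes "p \<in> S" "z \<notin> affine hull S"
  obtains c \<gamma> where "\<forall>x\<in>S. c \<bullet> x = \<gamma>" "c \<bullet> z \<noteq> \<gamma>"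
proof -
  define D where "D = (\<lambda>x. x - p) ` (S - {p})"
  obtain w q where wq: "w \<in> span D" "\<And>x. x \<in> span D \<Longrightarrow> orthogonal q x" "z - p = w + q"
    using orthogonal_subspace_decomp_exists[of D "z - p"] by metis
  have "q \<noteq> 0"
  proof
    assume "q = 0"
    then have "p + w = z"
      using wq(3) by (simp add: algebra_simps)
    moreover have "p + w \<in> affine hull S"
      using wq(1) affine_hull_span2[OF assms(1)] D_def by auto
    ultimately show False
      using assms(2) by simp
  qed
  have const: "q \<bullet> x = q \<bullet> p" if x: "x \<in> S" for x
  proof (cases "x = p")
    case False
    then have "x - p \<in> span D"
      using x by (intro span_base) (simp add: D_def)
    then have "orthogonal q (x - p)"
      by (rule wq(2))
    then show ?thesis
      by (simp add: orthogonal_def inner_diff_right)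
  qed simp
  have "q \<bullet> w = 0"
    using wq(2)[OF wq(1)] by (simp add: orthogonal_def)
  then have "q \<bullet> z - q \<bullet> p = q \<bullet> q"
    using wq(3) by (simp add: inner_add_right flip: inner_diff_right)
  moreover have "q \<bullet> q \<noteq> 0"
    using \<open>q \<noteq> 0\<close> by simp
  ultimately have "q \<bullet> z \<noteq> q \<bullet> p"
    by linarith
  with const show thesis
    by (intro that ballI)
qed

text \<open>A point of the hyperplane section missed by the affine hull of the face would be
  separated from it by a functional constant on the face. By \<open>mult\<close> such a functional
  is, on \<open>S\<close>, a multiple of \<open>a\<close> plus a constant, and so cannot
  separate.\<close>

lemma facet_definingI:
  fixes S :: "'a::euclidean_space set"
  assumes ge: "\<And>x. x \<in> S \<Longrightarrow> a \<bullet> x \<ge> b"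
    and pq: "p \<in> S" "a \<bullet> p = b" "q \<in> S" "a \<bullet> q \<noteq> b"
    and mult: "\<And>c \<gamma>. (\<And>x. x \<in> S \<Longrightarrow> a \<bullet> x = b \<Longrightarrow> c \<bullet> x = \<gamma>) \<Longrightarrow>
      \<exists>l. \<forall>x\<in>S. c \<bullet> x - \<gamma> = l * (a \<bullet> x - b)"
  shows "facet_defining S a b"
proof -
  let ?F = "{x \<in> S. a \<bullet> x = b}"
  have "affine hull ?F \<subseteq> affine hull S"
    by (rule hull_mono) auto
  moreover have "affine hull ?F \<subseteq> {x. a \<bullet> x = b}"
    using affine_hull_constI[of ?F a b] by auto
  moreover have "z \<in> affine hull ?F" if z: "z \<in> affine hull S" "a \<bullet> z = b" for z
  proof (rule ccontr)
    assume nz: "z \<notin> affine hull ?F"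
    have p: "p \<in> ?F"
      using pq by simp
    obtain c \<gamma> where c: "\<forall>x\<in>?F. c \<bullet> x = \<gamma>" "c \<bullet> z \<noteq> \<gamma>"
      using not_in_affine_hullE[OF p nz] .
    then obtain l where l: "\<forall>x\<in>S. c \<bullet> x - \<gamma> = l * (a \<bullet> x - b)"
      using mult[of c \<gamma>] by auto
    have "(c - l *\<^sub>R a) \<bullet> x = \<gamma> - l * b" if "x \<in> S" for x
      using bspec[OF l that] by (simp add: inner_diff_left algebra_simps)
    then have "(c - l *\<^sub>R a) \<bullet> z = \<gamma> - l * b"
      using z(1) by (rule affine_hull_constI)
    then show False
      using c(2) z(2) by (simp add: inner_diff_left)
  qed
  ultimately show ?thesis
    using facet_defining_iff[OF ge pq] by blast
qed

text \<open>For a facet, the affine hull of the face contains the affine combination of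
  \<open>M0\<close>, \<open>M1\<close> and \<open>M\<close> with coefficients 1, 1 and -1, because
  its coordinates at \<open>e\<close> cancel. The coordinate at \<open>f\<close> is at most the one
  at \<open>e\<close>, hence 0 on the face and on its affine hull. If \<open>f\<close> were missing
  from \<open>M\<close>, this combination would have value 1 at \<open>f\<close>.\<close>

lemma facet_defining_coordinate_eq:
  fixes G :: "('v, 'e::finite) ugraph"
  assumes facet: "facet_defining (PM_polytope G) (axis e 1) 0"
    and dep: "\<And>M. perfect_matching G M \<Longrightarrow> f \<in> M \<Longrightarrow> e \<in> M"
    and M0: "perfect_matching G M0" "e \<notin> M0"
    and M1: "perfect_matching G M1" "f \<in> M1"
    and M: "perfect_matching G M" "e \<in> M"
  shows "f \<in> M"
proof (rule ccontr)
  assume "f \<notin> M"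
  let ?S = "PM_polytope G"
  let ?F = "{x \<in> ?S. axis e 1 \<bullet> x = 0}"
  let ?i = "incidence_vector :: 'e set \<Rightarrow> real ^ 'e"
  have e: "e \<in> M1"
    using dep M1 by blast
  have ge: "axis e 1 \<bullet> x \<ge> 0" if "x \<in> ?S" for x
    using facet that by (simp add: facet_defining_def)
  have "axis f 1 \<bullet> x = 0" if x: "x \<in> ?F" for x
  proof -
    have "(axis f 1 - axis e 1) \<bullet> x \<le> 0"
    proof (rule PM_polytope_le[of G])
      fix N assume "perfect_matching G N"
      then show "(axis f 1 - axis e 1) \<bullet> ?i N \<le> 0"
        using dep by (auto simp: inner_diff_left inner_axis' indicator_def)
    qed (use x in simp)
    moreover have "(- axis f 1) \<bullet> x \<le> 0"
      by (rule PM_polytope_le[of G]) (use x in \<open>auto simp: inner_axis' indicator_def\<close>)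
    ultimately show ?thesis
      using x by (simp add: inner_diff_left)
  qed
  moreover have "affine hull ?F = affine hull ?S \<inter> {x. axis e 1 \<bullet> x = 0}"
  proof -
    have "facet_defining ?S (axis e 1) 0 \<longleftrightarrow>
        affine hull ?F = affine hull ?S \<inter> {x. axis e 1 \<bullet> x = 0}"
      by (rule facet_defining_iff[where p = "?i M0" and q = "?i M1"])
        (use ge M0 M1 e in \<open>auto simp: incidence_vector_in_PM inner_axis'\<close>)
    then show ?thesis
      using facet by blast
  qed
  moreover have "?i M0 + 1 *\<^sub>R (?i M1 - ?i M) \<in> affine hull ?S"
    using mem_affine_3_minus[of "affine hull ?S" "?i M0" "?i M1" "?i M" 1] M0 M1 M
    by (simp add: hull_inc incidence_vector_in_PM affine_affine_hull)
  then have "?i M0 + (?i M1 - ?i M) \<in> affine hull ?S \<inter> {x. axis e 1 \<bullet> x = 0}"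
    using e M M0 by (simp add: inner_axis')
  ultimately have "axis f 1 \<bullet> (?i M0 + (?i M1 - ?i M)) = 0"
    using affine_hull_constI[of ?F "axis f 1" 0] by blast
  moreover have "f \<notin> M0"
    using dep M0 by blast
  ultimately show False
    using M1 \<open>f \<notin> M\<close> by (simp add: inner_axis')
qed


section \<open>Tight cut contractions\<close>

text \<open>The vertex map behind \<open>contract\<close>. What matters about the arbitrary
  representative is that the map is constant on \<open>U\<close> with a value in \<open>U\<close>,
  and the identity elsewhere.\<close>

definition shrink :: "'v set \<Rightarrow> 'v \<Rightarrow> 'v" where
  "shrink U v = (if v \<in> U then SOME u. u \<in> U else v)"

definition unshrink :: "('v, 'e) ugraph \<Rightarrow> 'v set \<Rightarrow> 'v set \<Rightarrow> 'v set" where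
  "unshrink H U X = {v \<in> verts H. shrink U v \<in> X}"

lemma edges_contract: "edges (contract H U) = {f \<in> edges H. \<not> ends H f \<subseteq> U}"
  by (simp add: contract_def Let_def)

lemma ends_contract: "ends (contract H U) f = shrink U ` ends H f"
  by (simp add: contract_def Let_def shrink_def)

lemma verts_contract: "verts (contract H U) = insert (SOME u. u \<in> U) (verts H - U)"
  by (simp add: contract_def Let_def)

lemma shrink_outside [simp]: "v \<notin> U \<Longrightarrow> shrink U v = v"
  by (simp add: shrink_def)

lemma shrink_inside: "u \<in> U \<Longrightarrow> v \<in> U \<Longrightarrow> shrink U u = shrink U v"
  by (simp add: shrink_def)

lemma shrink_in: "v \<in> U \<Longrightarrow> shrink U v \<in> U"
  unfolding shrink_def by (simp add: someI[of "\<lambda>u. u \<in> U"])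

lemma shrink_in_iff: "shrink U v \<in> U \<longleftrightarrow> v \<in> U"
  using shrink_in by (cases "v \<in> U") auto

lemma verts_contract': "x \<in> U \<Longrightarrow> verts (contract H U) = insert (shrink U x) (verts H - U)"
  by (simp add: verts_contract shrink_def)

text \<open>A surviving edge has an end outside \<open>U\<close>. Calling it \<open>b\<close> leaves
  only the position of \<open>a\<close> open, and the last condition says that contraction creates
  no loops among the surviving edges.\<close>

lemma contract_edgeE:
  assumes "wf_ugraph H" "f \<in> edges (contract H U)"
  obtains a b where "f \<in> edges H" "ends H f = {a, b}" "a \<noteq> b" "a \<in> verts H" "b \<in> verts H"
    "b \<notin> U" "ends (contract H U) f = {shrink U a, b}" "shrink U a \<noteq> b"
proof -
  have f: "f \<in> edges H" "\<not> ends H f \<subseteq> U"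
    using assms(2) by (simp_all add: edges_contract)
  obtain a b where ab: "ends H f = {a, b}" "a \<noteq> b" "a \<in> verts H" "b \<in> verts H"
    using wf_ugraph_edgeE[OF assms(1) f(1)] .
  have neq: "shrink U x \<noteq> y" if "x \<noteq> y" "y \<notin> U" for x y
    using that shrink_in[of x U] by (cases "x \<in> U") auto
  show thesis
  proof (cases "b \<in> U")
    case True
    then have "a \<notin> U"
      using f ab by auto
    then show ?thesis
      using that[of b a] f ab neq[of b a] by (simp add: ends_contract insert_commute)
  next
    case False
    then show ?thesis
      using that[of a b] f ab neq[of a b] by (simp add: ends_contract)
  qed
qed

lemma wf_contract:
  assumes "wf_ugraph H" "U \<subseteq> verts H" "U \<noteq> {}"
  shows "wf_ugraph (contract H U)"
proof -
  obtain x where x: "x \<in> U"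
    using assms(3) by blast
  have "ends (contract H U) f \<subseteq> verts (contract H U) \<and> card (ends (contract H U) f) = 2"
    if f: "f \<in> edges (contract H U)" for f
  proof -
    obtain a b where ab: "f \<in> edges H" "ends H f = {a, b}" "a \<noteq> b" "a \<in> verts H" "b \<in> verts H"
        "b \<notin> U" "ends (contract H U) f = {shrink U a, b}" "shrink U a \<noteq> b"
      using contract_edgeE[OF assms(1) f] .
    moreover have "shrink U a \<in> verts (contract H U)"
      using ab(4) x shrink_inside[of a U x] by (cases "a \<in> U") (simp_all add: verts_contract')
    ultimately show ?thesis
      using x by (simp add: verts_contract')
  qed
  then show ?thesis
    using assms(1) by (auto simp: wf_ugraph_def verts_contract edges_contract)
qed

text \<open>A preimage under \<open>shrink U\<close> never separates two vertices of
  \<open>U\<close>, so the discarded edges do not lie in its cut.\<close>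

lemma cut_contract:
  assumes "wf_ugraph H"
  shows "cut (contract H U) X = cut H (unshrink H U X)"
proof -
  have "f \<in> cut (contract H U) X \<longleftrightarrow> f \<in> cut H (unshrink H U X)"
    if f: "f \<in> edges (contract H U)" for f
  proof -
    obtain a b where ab: "f \<in> edges H" "ends H f = {a, b}" "a \<noteq> b" "a \<in> verts H" "b \<in> verts H"
      "b \<notin> U" "ends (contract H U) f = {shrink U a, b}" "shrink U a \<noteq> b"
      using contract_edgeE[OF assms f] .
    then show ?thesis
      using in_cut_iff[OF f ab(7,8), of X] in_cut_iff[OF ab(1-3), of "unshrink H U X"]
      by (simp add: unshrink_def)
  qed
  moreover have "f \<in> edges (contract H U)" if f: "f \<in> cut H (unshrink H U X)" for f
  proof (rule ccontr)
    assume "f \<notin> edges (contract H U)"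
    moreover have fe: "f \<in> edges H"
      using f by (simp add: cut_def)
    ultimately have sub: "ends H f \<subseteq> U"
      by (simp add: edges_contract)
    obtain a b where ab: "ends H f = {a, b}" "a \<noteq> b" "a \<in> verts H" "b \<in> verts H"
      using wf_ugraph_edgeE[OF assms fe] .
    then have "shrink U a = shrink U b"
      using sub shrink_inside[of a U b] by simp
    then show False
      using f in_cut_iff[OF fe ab(1,2), of "unshrink H U X"] ab(3,4) by (simp add: unshrink_def)
  qed
  moreover have "f \<in> edges (contract H U)" if "f \<in> cut (contract H U) X" for f
    using that by (simp add: cut_def)
  ultimately show ?thesis
    by blast
qed

lemma tight_cutD:
  assumes "tight_cut H U"
  shows "U \<subseteq> verts H" "odd (card U)" "odd (card (verts H - U))" "U \<noteq> {}"
    "\<And>M. perfect_matching H M \<Longrightarrow> card (M \<inter> cut H U) = 1"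
  using assms by (auto simp: tight_cut_def)

text \<open>The edges at the new vertex are those of \<open>cut H U\<close>, and tightness says that
  the matching has exactly one of them. At the other vertices nothing changes.\<close>

lemma perfect_matching_contract:
  assumes wf: "wf_ugraph H" and U: "tight_cut H U" and M: "perfect_matching H M"
  shows "perfect_matching (contract H U) (M \<inter> edges (contract H U))"
  unfolding perfect_matching_def
proof (intro conjI ballI)
  obtain x where x: "x \<in> U"
    using tight_cutD(4)[OF U] by blast
  fix v assume v: "v \<in> verts (contract H U)"
  show "\<exists>!f. f \<in> M \<inter> edges (contract H U) \<and> v \<in> ends (contract H U) f"
  proof (cases "v \<in> U")
    case True
    have "f \<in> M \<inter> edges (contract H U) \<and> v \<in> ends (contract H U) f \<longleftrightarrow> f \<in> M \<inter> cut H U" for f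
    proof (cases "f \<in> edges (contract H U)")
      case fc: True
      obtain a b where ab: "f \<in> edges H" "ends H f = {a, b}" "a \<noteq> b" "a \<in> verts H" "b \<in> verts H"
        "b \<notin> U" "ends (contract H U) f = {shrink U a, b}" "shrink U a \<noteq> b"
        using contract_edgeE[OF wf fc] .
      have "v = shrink U x"
        using v True by (simp add: verts_contract'[OF x])
      moreover have "v \<noteq> b"
        using True ab(6) by blast
      ultimately have "v \<in> ends (contract H U) f \<longleftrightarrow> shrink U x = shrink U a"
        using ab(7) by simp
      also have "\<dots> \<longleftrightarrow> a \<in> U"
        using x shrink_in_iff[of U] shrink_inside[of a U x] by metis
      finally have "v \<in> ends (contract H U) f \<longleftrightarrow> a \<in> U" .
      then show ?thesis
        using fc ab(6) in_cut_iff[OF ab(1-3), of U] by auto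
    next
      case False
      have "f \<notin> cut H U"
      proof
        assume c: "f \<in> cut H U"
        then have f: "f \<in> edges H"
          by (simp add: cut_def)
        obtain a b where "ends H f = {a, b}" "a \<noteq> b" "a \<in> verts H" "b \<in> verts H"
          using wf_ugraph_edgeE[OF wf f] .
        moreover have "ends H f \<subseteq> U"
          using False f by (simp add: edges_contract)
        ultimately show False
          using c in_cut_iff[OF f, of a b U] by simp
      qed
      then show ?thesis
        using False by simp
    qed
    moreover obtain g where "M \<inter> cut H U = {g}"
      using tight_cutD(5)[OF U M] by (rule card_1_singletonE)
    ultimately show ?thesis
      by simp
  next
    case False
    then have vH: "v \<in> verts H"
      using v x shrink_in[of x U] by (auto simp: verts_contract')
    have eq: "f \<in> M \<inter> edges (contract H U) \<and> v \<in> ends (contract H U) f \<longleftrightarrow> f \<in> M \<and> v \<in> ends H f" for f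
    proof -
      have "v \<in> shrink U ` ends H f \<longleftrightarrow> v \<in> ends H f"
      proof
        assume "v \<in> shrink U ` ends H f"
        then obtain w where w: "w \<in> ends H f" "v = shrink U w"
          by blast
        then have "w \<notin> U"
          using False shrink_in[of w U] by auto
        then show "v \<in> ends H f"
          using w by simp
      next
        assume "v \<in> ends H f"
        then show "v \<in> shrink U ` ends H f"
          using False by (intro image_eqI[of _ _ v]) simp_all
      qed
      moreover have "M \<subseteq> edges H"
        using M by (simp add: perfect_matching_def)
      ultimately show ?thesis
        using False by (auto simp: ends_contract edges_contract)
    qed
    show ?thesis
      unfolding eq using M vH unfolding perfect_matching_def by blast
  qed
qed simp

text \<open>The preimage is \<open>X\<close> itself, or it arises from \<open>X\<close> by replacing
  one vertex with the odd set \<open>U\<close>.\<close>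

lemma odd_card_unshrink:
  assumes wf: "wf_ugraph H" and U: "tight_cut H U" and X: "X \<subseteq> verts (contract H U)"
  shows "odd (card (unshrink H U X)) \<longleftrightarrow> odd (card X)"
proof -
  obtain x where x: "x \<in> U"
    using tight_cutD(4)[OF U] by blast
  have UH: "U \<subseteq> verts H"
    by (rule tight_cutD(1)[OF U])
  have fin: "finite (verts H)"
    using wf by (simp add: wf_ugraph_def)
  then have finX: "finite X"
    using X by (auto simp: verts_contract intro: finite_subset)
  show ?thesis
  proof (cases "shrink U x \<in> X")
    case True
    have sub: "X - {shrink U x} \<subseteq> verts H - U"
      using X x by (auto simp: verts_contract')
    have "unshrink H U X = (X - {shrink U x}) \<union> U"
    proof (intro equalityI subsetI)
      fix v assume "v \<in> unshrink H U X"
      then show "v \<in> (X - {shrink U x}) \<union> U"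
        using x shrink_in[of x U] by (cases "v \<in> U") (auto simp: unshrink_def)
    next
      fix v assume v: "v \<in> (X - {shrink U x}) \<union> U"
      show "v \<in> unshrink H U X"
      proof (cases "v \<in> U")
        case True
        then show ?thesis
          using UH x \<open>shrink U x \<in> X\<close> shrink_inside[of v U x] by (auto simp: unshrink_def)
      next
        case False
        then show ?thesis
          using v sub by (auto simp: unshrink_def)
      qed
    qed
    moreover have "card ((X - {shrink U x}) \<union> U) = card (X - {shrink U x}) + card U"
      using sub fin finX UH by (intro card_Un_disjoint) (auto intro: finite_subset)
    moreover have "card X = Suc (card (X - {shrink U x}))"
      using True finX by (intro card.remove)
    ultimately show ?thesis
      using tight_cutD(2)[OF U] by simp
  next
    case False
    have "unshrink H U X = X"
    proof (intro equalityI subsetI)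
      fix v assume "v \<in> unshrink H U X"
      then show "v \<in> X"
        using False x shrink_inside[of v U x] by (cases "v \<in> U") (auto simp: unshrink_def)
    next
      fix v assume "v \<in> X"
      then have "v \<in> verts H - U"
        using X x False by (auto simp: verts_contract')
      then show "v \<in> unshrink H U X"
        using \<open>v \<in> X\<close> by (simp add: unshrink_def)
    qed
    then show ?thesis
      by simp
  qed
qed

lemma unshrink_Compl:
  assumes "U \<subseteq> verts H" "U \<noteq> {}"
  shows "verts H - unshrink H U X = unshrink H U (verts (contract H U) - X)"
proof -
  obtain x where x: "x \<in> U"
    using assms(2) by blast
  have "shrink U v \<in> verts (contract H U)" if "v \<in> verts H" for v
    using that x shrink_inside[of v U x] by (cases "v \<in> U") (simp_all add: verts_contract')
  then show ?thesis
    by (auto simp: unshrink_def)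
qed

lemma tight_cut_unshrink:
  assumes wf: "wf_ugraph H" and U: "tight_cut H U" and X: "tight_cut (contract H U) X"
  shows "tight_cut H (unshrink H U X)"
  unfolding tight_cut_def
proof (intro conjI allI impI)
  show "unshrink H U X \<subseteq> verts H"
    by (auto simp: unshrink_def)
  show "odd (card (unshrink H U X))"
    using odd_card_unshrink[OF wf U] tight_cutD(1,2)[OF X] by blast
  show "odd (card (verts H - unshrink H U X))"
    unfolding unshrink_Compl[OF tight_cutD(1,4)[OF U]]
    using odd_card_unshrink[OF wf U] tight_cutD(3)[OF X] by (meson Diff_subset)
  fix M assume M: "perfect_matching H M"
  have "M \<inter> edges (contract H U) \<inter> cut (contract H U) X = M \<inter> cut H (unshrink H U X)"
    using cut_contract[OF wf, of U X] by (auto simp: cut_def)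
  then show "card (M \<inter> cut H (unshrink H U X)) = 1"
    using tight_cutD(5)[OF X perfect_matching_contract[OF wf U M]] by simp
qed

lemma matching_covered_contract:
  assumes H: "matching_covered H" and U: "tight_cut H U"
  shows "matching_covered (contract H U)"
  unfolding matching_covered_def
proof (intro conjI ballI)
  note wf = matching_coveredD(1)[OF H]
  obtain x where x: "x \<in> U"
    using tight_cutD(4)[OF U] by blast
  show wf': "wf_ugraph (contract H U)"
    using wf_contract[OF wf] tight_cutD(1,4)[OF U] .
  have "card (verts (contract H U)) = Suc (card (verts H - U))"
    using wf x shrink_in[of x U] by (simp add: verts_contract' wf_ugraph_def)
  then show "even (card (verts (contract H U)))"
    using tight_cutD(3)[OF U] by simp
  show "connected_ugraph (contract H U)"
    unfolding connected_ugraph_iff_cut[OF wf']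
  proof (intro allI impI)
    fix K assume K: "K \<subseteq> verts (contract H U) \<and> K \<noteq> {} \<and> K \<noteq> verts (contract H U)"
    have ne: "unshrink H U L \<noteq> {}" if L: "L \<subseteq> verts (contract H U)" "L \<noteq> {}" for L
    proof -
      obtain v where v: "v \<in> L"
        using L by blast
      have "v = shrink U x \<or> v \<in> verts H - U"
        using L(1) v x by (auto simp: verts_contract')
      then have "v \<in> unshrink H U L \<or> x \<in> unshrink H U L"
        using v x tight_cutD(1)[OF U] by (auto simp: unshrink_def)
      then show ?thesis
        by blast
    qed
    have "unshrink H U (verts (contract H U) - K) \<noteq> {}"
      using K by (intro ne) auto
    then have "unshrink H U K \<noteq> verts H"
      using unshrink_Compl[OF tight_cutD(1,4)[OF U], of K] by auto
    moreover have "unshrink H U K \<noteq> {}"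
      using K by (intro ne) auto
    moreover have "unshrink H U K \<subseteq> verts H"
      by (auto simp: unshrink_def)
    ultimately show "cut (contract H U) K \<noteq> {}"
      using matching_coveredD(3)[OF H] unfolding connected_ugraph_iff_cut[OF wf] cut_contract[OF wf]
      by blast
  qed
  show "\<exists>M. perfect_matching (contract H U) M \<and> f \<in> M" if f: "f \<in> edges (contract H U)" for f
  proof -
    have "f \<in> edges H"
      using f by (simp add: edges_contract)
    then obtain M where "perfect_matching H M" "f \<in> M"
      using matching_coveredD(5)[OF H] by blast
    then show ?thesis
      using perfect_matching_contract[OF wf U] f by blast
  qed
  obtain f where "f \<in> edges H"
    using matching_coveredD(4)[OF H] by blast
  then obtain M where M: "perfect_matching H M"
    using matching_coveredD(5)[OF H] by blast
  have "shrink U x \<in> verts (contract H U)"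
    using x by (simp add: verts_contract')
  then obtain g where "g \<in> M \<inter> edges (contract H U)"
    using perfect_matching_edge_at[OF perfect_matching_contract[OF wf U M]] by blast
  then show "edges (contract H U) \<noteq> {}"
    by blast
qed

lemma card_verts_contract_less:
  assumes wf: "wf_ugraph H" and U: "U \<subseteq> verts H" "card U > 1"
  shows "card (verts (contract H U)) < card (verts H)"
proof -
  have fin: "finite (verts H)"
    using wf by (simp add: wf_ugraph_def)
  then have "card (verts (contract H U)) \<le> Suc (card (verts H - U))"
    unfolding verts_contract by (intro card_insert_le_m1) auto
  also have "\<dots> < card (verts H)"
    using U fin card_mono[OF fin U(1)] card_Diff_subset[of U "verts H"] finite_subset[OF U(1) fin] by linarith
  finally show ?thesis .
qed


section \<open>Near-bricks\<close>

text \<open>The new vertex receives the colour \<open>\<tau>\<close>. Edges inside \<open>U\<close>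
  disappear, so the colouring is tested only outside \<open>U\<close> and on the boundary.\<close>

lemma bipartite_contractI:
  fixes H :: "('v, 'e) ugraph" and s :: "'v \<Rightarrow> bool"
  assumes wf: "wf_ugraph H" and U: "U \<subseteq> verts H" "U \<noteq> {}"
    and outside: "\<And>f a b. f \<in> edges H \<Longrightarrow> ends H f = {a, b} \<Longrightarrow> a \<notin> U \<Longrightarrow> b \<notin> U \<Longrightarrow> s a \<noteq> s b"
    and boundary: "\<And>f a b. f \<in> edges H \<Longrightarrow> ends H f = {a, b} \<Longrightarrow> a \<in> U \<Longrightarrow> b \<notin> U \<Longrightarrow> s b \<noteq> \<tau>"
  shows "bipartite (contract H U)"
proof -
  define t where "t v = (if v \<in> U then \<tau> else s v)" for v
  show ?thesis
  proof (rule bipartiteI[OF wf_contract[OF wf U]])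
    fix f c d assume f: "f \<in> edges (contract H U)" and cd: "ends (contract H U) f = {c, d}"
    obtain a b where ab: "f \<in> edges H" "ends H f = {a, b}" "a \<noteq> b" "a \<in> verts H" "b \<in> verts H"
      "b \<notin> U" "ends (contract H U) f = {shrink U a, b}" "shrink U a \<noteq> b"
      using contract_edgeE[OF wf f] .
    have "t (shrink U a) \<noteq> t b"
    proof (cases "a \<in> U")
      case True
      then show ?thesis
        using boundary[OF ab(1,2) True ab(6)] shrink_in[OF True] ab(6) by (simp add: t_def)
    next
      case False
      then show ?thesis
        using outside[OF ab(1,2) False ab(6)] ab(6) by (simp add: t_def)
    qed
    then show "t c \<noteq> t d"
      using ab(7) cd by (auto simp: doubleton_eq_iff)
  qed
qed

text \<open>All boundary edges must leave \<open>U\<close> from the same colour class. A perfect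
  matching has one edge in the cut, and its other edges meeting \<open>U\<close> pair off opposite
  colours inside \<open>U\<close>. So the colour of the end in \<open>U\<close> of the cut edge is
  the surplus colour of \<open>U\<close>, which does not depend on the matching; \<open>y\<close>
  measures this surplus.\<close>

lemma bipartite_contract:
  assumes H: "matching_covered H" "bipartite H" and U: "tight_cut H U"
  shows "bipartite (contract H U)"
proof -
  note wf = matching_coveredD(1)[OF H(1)]
  obtain s :: "_ \<Rightarrow> bool" where s: "\<forall>f\<in>edges H. \<forall>a b. ends H f = {a, b} \<longrightarrow> s a \<noteq> s b"
    using bipartiteE[OF H(2)] .
  have col: "s a \<noteq> s b" if "f \<in> edges H" "ends H f = {a, b}" for f a b
    using bspec[OF s that(1)] that(2) by simp
  define y :: "_ \<Rightarrow> int" where "y v = (if v \<in> U then if s v then 1 else - 1 else 0)" for v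
  have bd: "s a \<longleftrightarrow> sum y (verts H) = 1"
    if f: "f \<in> edges H" "ends H f = {a, b}" "a \<in> U" "b \<notin> U" for f a b
  proof -
    obtain M where M: "perfect_matching H M" "f \<in> M"
      using matching_coveredD(5)[OF H(1) f(1)] by blast
    have fM: "f \<in> M \<inter> cut H U"
      using in_cut_iff[OF f(1,2), of U] wf_ugraph_endsD[OF wf f(1,2)] f M by blast
    obtain g where g: "M \<inter> cut H U = {g}"
      using tight_cutD(5)[OF U M(1)] by (rule card_1_singletonE)
    have ME: "M \<subseteq> edges H" "finite M"
      using M wf by (auto simp: perfect_matching_def wf_ugraph_def intro: finite_subset)
    have "sum y (ends H h) = 0" if h: "h \<in> M - {f}" for h
    proof -
      have he: "h \<in> edges H" "h \<notin> cut H U"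
        using h g fM ME by auto
      obtain c d where cd: "ends H h = {c, d}" "c \<noteq> d" "c \<in> verts H" "d \<in> verts H"
        using wf_ugraph_edgeE[OF wf he(1)] .
      then show ?thesis
        using col[OF he(1) cd(1)] he(2) in_cut_iff[OF he(1) cd(1,2), of U] by (simp add: y_def)
    qed
    then have "(\<Sum>h\<in>M. sum y (ends H h)) = sum y (ends H f)"
      using ME M(2) by (simp add: sum.remove[of M f])
    moreover have "sum y (ends H f) = (if s a then 1 else - 1)"
      using f wf_ugraph_endsD[OF wf f(1,2)] by (simp add: y_def)
    ultimately show ?thesis
      using perfect_matching_sum[OF wf M(1), of y] by (auto split: if_splits)
  qed
  show ?thesis
  proof (rule bipartite_contractI[OF wf tight_cutD(1,4)[OF U]])
    show "s a \<noteq> s b" if "f \<in> edges H" "ends H f = {a, b}" for f a b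
      using col[OF that] .
    show "s b \<noteq> (sum y (verts H) = 1)" if f: "f \<in> edges H" "ends H f = {a, b}" "a \<in> U" "b \<notin> U" for f a b
      using bd[OF f] col[OF f(1,2)] by blast
  qed
qed

text \<open>What remains of the Birkhoff von Neumann property under tight cut contractions.\<close>

definition tight_cuts_spanned :: "('v, 'e) ugraph \<Rightarrow> bool" where
  "tight_cuts_spanned H \<longleftrightarrow> (\<forall>U. tight_cut H U \<longrightarrow>
     (\<exists>y :: 'v \<Rightarrow> real. \<forall>f\<in>edges H. indicator (cut H U) f = sum y (ends H f)))"

lemma BvN_tight_cuts_spanned:
  fixes H :: "('v, 'e::finite) ugraph"
  assumes H: "matching_covered H" and PM: "PM_polytope H = P_polytope H"
  shows "tight_cuts_spanned H"
  unfolding tight_cuts_spanned_def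
proof (intro allI impI)
  fix U assume U: "tight_cut H U"
  have "(\<Sum>f\<in>M. indicator (cut H U) f :: real) = 1" if M: "perfect_matching H M" for M
  proof -
    have "finite M"
      using M matching_coveredD(1)[OF H]
      by (auto simp: perfect_matching_def wf_ugraph_def intro: finite_subset)
    then show ?thesis
      using tight_cutD(5)[OF U M] by (simp add: indicator_def[abs_def] of_bool_def sum.If_cases)
  qed
  then show "\<exists>y :: 'v \<Rightarrow> real. \<forall>f\<in>edges H. indicator (cut H U) f = sum y (ends H f)"
    using BvN_potential[OF matching_coveredD(1,5)[OF H] PM, of "indicator (cut H U)" 1] by metis
qed

text \<open>The colour \<open>True\<close> marks the class through which the cut leaves
  \<open>X\<close>. Seen from outside, \<open>X\<close> behaves like a single vertex of this colour;
  seen from \<open>X\<close>, the complement behaves like a vertex of colour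
  \<open>False\<close>.\<close>

definition bipartite_shore :: "('v, 'e) ugraph \<Rightarrow> 'v set \<Rightarrow> ('v \<Rightarrow> bool) \<Rightarrow> bool" where
  "bipartite_shore H X s \<longleftrightarrow> (\<forall>f\<in>edges H. \<forall>a b. ends H f = {a, b} \<longrightarrow> a \<in> X \<longrightarrow>
     (if b \<in> X then s a \<noteq> s b else s a))"

lemma bipartite_shoreD:
  assumes "bipartite_shore H X s" "f \<in> edges H" "ends H f = {a, b}" "a \<in> X"
  shows "b \<in> X \<Longrightarrow> s a \<noteq> s b" "b \<notin> X \<Longrightarrow> s a"
  using assms by (auto simp: bipartite_shore_def)

text \<open>Inner edges of the shore lie outside the cut, so the potential changes sign along them,
  and the shore is connected.\<close>

lemma potential_shore_abs_const:
  fixes y :: "'v \<Rightarrow> real"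
  assumes H: "matching_covered H" and U: "tight_cut H U"
    and y: "\<forall>f\<in>edges H. indicator (cut H U) f = sum y (ends H f)"
    and uv: "u \<in> U" "v \<in> U"
  shows "\<bar>y u\<bar> = \<bar>y v\<bar>"
proof (rule tight_cut_shore_const[OF H U _ uv])
  fix f a b assume f: "f \<in> edges H" and ab: "ends H f = {a, b}" "a \<noteq> b" "a \<in> U" "b \<in> U"
  have "indicator (cut H U) f = y a + y b"
    using y f ab(1,2) by simp
  then have "y a + y b = 0"
    using in_cut_iff[OF f ab(1,2), of U] ab(3,4) by simp
  then show "\<bar>y a\<bar> = \<bar>y b\<bar>"
    by linarith
qed

text \<open>The absolute value of \<open>y\<close> is constant on each shore, and the two values on
  a boundary edge add up to 1. If one shore carries 0, the other carries 1 and -1, its signs form a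
  bipartition, and its boundary ends all have value 1. If neither shore carries 0, changing a sign
  in \<open>y p + y q = 1\<close> destroys the equation, so all boundary edges see the same pair of
  values and the whole graph is bipartite.\<close>

lemma potential_bipartite_shore:
  fixes H :: "('v, 'e) ugraph" and y :: "'v \<Rightarrow> real"
  assumes H: "matching_covered H" "\<not> bipartite H" and U: "tight_cut H U"
    and y: "\<forall>f\<in>edges H. indicator (cut H U) f = sum y (ends H f)"
  obtains s where "bipartite_shore H U s" | s where "bipartite_shore H (verts H - U) s"
proof -
  note wf = matching_coveredD(1)[OF H(1)]
  let ?W = "verts H - U"
  have W: "tight_cut H ?W"
    using tight_cut_Compl[OF wf U] .
  have inner: "y a = - y b"
    if "f \<in> edges H" "ends H f = {a, b}" "(a \<in> U) = (b \<in> U)" for f a b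
    using y that in_cut_iff[OF that(1,2), of U] wf_ugraph_endsD[OF wf that(1,2)] by auto
  have bd: "y a + y b = 1"
    if "f \<in> edges H" "ends H f = {a, b}" "(a \<in> U) \<noteq> (b \<in> U)" for f a b
    using y that in_cut_iff[OF that(1,2), of U] wf_ugraph_endsD[OF wf that(1,2)] by auto
  have absU: "\<bar>y a\<bar> = \<bar>y b\<bar>" if "a \<in> U" "b \<in> U" for a b
    using potential_shore_abs_const[OF H(1) U y that] .
  have absW: "\<bar>y a\<bar> = \<bar>y b\<bar>" if "a \<in> ?W" "b \<in> ?W" for a b
    using potential_shore_abs_const[OF H(1) W _ that] y by (simp add: cut_Compl[OF wf])
  obtain f where f: "f \<in> edges H"
    using matching_coveredD(4)[OF H(1)] by blast
  obtain M where M: "perfect_matching H M"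
    using matching_coveredD(5)[OF H(1) f] by blast
  obtain g where g: "g \<in> cut H U"
    using tight_cutD(5)[OF U M] card_1_singletonE by blast
  have ge: "g \<in> edges H"
    using g by (simp add: cut_def)
  obtain p q where pq: "ends H g = {p, q}" "p \<in> U" "q \<in> ?W"
  proof -
    obtain a b where ab: "ends H g = {a, b}" "a \<noteq> b" "a \<in> verts H" "b \<in> verts H"
      using wf_ugraph_edgeE[OF wf ge] .
    then show thesis
      using that[of a b] that[of b a] in_cut_iff[OF ge ab(1,2), of U] g by (auto simp: insert_commute)
  qed
  have pq1: "y p + y q = 1"
    using bd[OF ge pq(1)] pq by blast
  have endsW: "b \<in> ?W" if "f \<in> edges H" "ends H f = {a, b}" "b \<notin> U" for f a b
    using wf_ugraph_endsD[OF wf that(1,2)] that(3) by blast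
  consider "y q = 0" | "y p = 0" | "y p \<noteq> 0" "y q \<noteq> 0"
    by blast
  then show thesis
  proof cases
    case 1
    have "bipartite_shore H U (\<lambda>v. y v > 0)"
      unfolding bipartite_shore_def
    proof (intro ballI allI impI)
      fix f a b assume f: "f \<in> edges H" "ends H f = {a, b}" "a \<in> U"
      show "if b \<in> U then (y a > 0) \<noteq> (y b > 0) else y a > 0"
        using inner[OF f(1,2)] bd[OF f(1,2)] endsW[OF f(1,2)] f(3) absU[OF f(3) pq(2)]
          absW[of b q] pq(3) 1 pq1 by auto
    qed
    then show thesis
      by (rule that(1))
  next
    case 2
    have "bipartite_shore H ?W (\<lambda>v. y v > 0)"
      unfolding bipartite_shore_def
    proof (intro ballI allI impI)
      fix f a b assume f: "f \<in> edges H" "ends H f = {a, b}" "a \<in> ?W"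
      show "if b \<in> ?W then (y a > 0) \<noteq> (y b > 0) else y a > 0"
        using inner[OF f(1,2)] bd[OF f(1,2)] endsW[OF f(1,2)] f(3) absW[OF f(3) pq(3)]
          absU[of b p] pq(2) 2 pq1 wf_ugraph_endsD[OF wf f(1,2)] by auto
    qed
    then show thesis
      by (rule that(2))
  next
    case 3
    \<comment> \<open>The colour compares signs with \<open>y p\<close> on \<open>U\<close> and is
      reversed, relative to \<open>y q\<close>, on the other shore; this makes the boundary edges
      bichromatic.\<close>
    define s where "s v = (if v \<in> U then y v = y p else y v \<noteq> y q)" for v
    have bd': "y a = y p \<and> y b = y q"
      if f: "f \<in> edges H" "ends H f = {a, b}" "a \<in> U" "b \<notin> U" for f a b
      using bd[OF f(1,2)] f(3,4) absU[OF f(3) pq(2)] absW[OF endsW[OF f(1,2,4)] pq(3)] pq1 3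
      by (simp add: abs_if split: if_splits)
    have "s a \<noteq> s b" if f: "f \<in> edges H" "ends H f = {a, b}" for f a b
    proof -
      have f': "ends H f = {b, a}"
        using f(2) by (simp add: insert_commute)
      consider "a \<in> U" "b \<in> U" | "a \<notin> U" "b \<notin> U" | "a \<in> U" "b \<notin> U" | "b \<in> U" "a \<notin> U"
        by blast
      then show ?thesis
      proof cases
        case 1
        then show ?thesis
          using inner[OF f] absU[OF _ pq(2), of a] 3 by (auto simp: s_def abs_if split: if_splits)
      next
        case 2
        then show ?thesis
          using inner[OF f] absW[OF _ pq(3), of a] endsW[OF f(1) f'] 3
          by (auto simp: s_def abs_if split: if_splits)
      next
        case 3
        then show ?thesis
          using bd'[OF f] by (simp add: s_def)
      next
        case 4
        then show ?thesis
          using bd'[OF f(1) f'] by (simp add: s_def)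
      qed
    qed
    then have "bipartite H"
      by (rule bipartiteI[OF wf])
    then show thesis
      using H(2) by blast
  qed
qed

lemma bipartite_contract_Compl:
  assumes H: "matching_covered H" and U: "tight_cut H U" and s: "bipartite_shore H U s"
  shows "bipartite (contract H (verts H - U))"
proof -
  note wf = matching_coveredD(1)[OF H]
  show ?thesis
  proof (rule bipartite_contractI[OF wf tight_cutD(1,4)[OF tight_cut_Compl[OF wf U]]])
    fix f a b assume f: "f \<in> edges H" "ends H f = {a, b}" and b: "b \<notin> verts H - U"
    have bU: "b \<in> U"
      using wf_ugraph_endsD[OF wf f] b by blast
    have f': "ends H f = {b, a}"
      using f(2) by (simp add: insert_commute)
    {
      assume "a \<notin> verts H - U"
      then have "a \<in> U"
        using wf_ugraph_endsD[OF wf f] by blast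
      then show "s a \<noteq> s b"
        using bipartite_shoreD(1)[OF s f(1) f' bU] by blast
    next
      assume "a \<in> verts H - U"
      then show "s b \<noteq> False"
        using bipartite_shoreD(2)[OF s f(1) f' bU] by blast
    }
  qed
qed

text \<open>Used in contrapositive form, to keep the contraction non-bipartite. The colouring of the
  contraction extends into \<open>U\<close> by \<open>s\<close>, flipped if necessary so that the
  class meeting the boundary gets the colour of the new vertex.\<close>

lemma bipartite_of_contract:
  assumes H: "matching_covered H" and U: "tight_cut H U" and s: "bipartite_shore H U s"
    and bip: "bipartite (contract H U)"
  shows "bipartite H"
proof -
  note wf = matching_coveredD(1)[OF H]
  obtain t :: "_ \<Rightarrow> bool" where t: "\<forall>f\<in>edges (contract H U). \<forall>a b. ends (contract H U) f = {a, b} \<longrightarrow> t a \<noteq> t b"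
    using bipartiteE[OF bip] .
  obtain x where x: "x \<in> U"
    using tight_cutD(4)[OF U] by blast
  define r where "r v = (if v \<in> U then s v = t (shrink U x) else t v)" for v
  have r: "r a \<noteq> r b" if f: "f \<in> edges H" "ends H f = {a, b}" and ab: "b \<notin> U \<or> a \<in> U" for f a b
  proof (cases "b \<in> U")
    case True
    then show ?thesis
      using bipartite_shoreD(1)[OF s f] ab by (auto simp: r_def)
  next
    case False
    have "t (shrink U a) \<noteq> t b"
    proof -
      have "f \<in> edges (contract H U)"
        using f False by (simp add: edges_contract)
      moreover have "ends (contract H U) f = {shrink U a, b}"
        using f False by (simp add: ends_contract)
      ultimately show ?thesis
        using t by blast
    qed
    moreover have "s a \<and> shrink U a = shrink U x" if "a \<in> U"
      using bipartite_shoreD(2)[OF s f that False] shrink_inside[OF that x] by simp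
    ultimately show ?thesis
      using False by (auto simp: r_def)
  qed
  show ?thesis
  proof (rule bipartiteI[OF wf])
    fix f a b assume f: "f \<in> edges H" "ends H f = {a, b}"
    have "ends H f = {b, a}"
      using f(2) by (simp add: insert_commute)
    then show "r a \<noteq> r b"
      using r[OF f] r[of f b a] f(1) by blast
  qed
qed

text \<open>The cut comes from a cut of \<open>H\<close> that contains no edge inside
  \<open>U\<close>, so its potential alternates in sign there. Correcting the sign by
  \<open>s\<close> gives a constant \<open>h x\<close> on the connected shore. Boundary edges start
  in the uncorrected class, so \<open>h x\<close> is the value that the new vertex needs.\<close>

lemma tight_cuts_spanned_contract:
  assumes H: "matching_covered H" and U: "tight_cut H U" and s: "bipartite_shore H U s"
    and span: "tight_cuts_spanned H"
  shows "tight_cuts_spanned (contract H U)"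
  unfolding tight_cuts_spanned_def
proof (intro allI impI)
  note wf = matching_coveredD(1)[OF H]
  fix Z assume Z: "tight_cut (contract H U) Z"
  let ?Z = "unshrink H U Z"
  obtain y :: "_ \<Rightarrow> real" where y: "\<forall>f\<in>edges H. indicator (cut H ?Z) f = sum y (ends H f)"
    using span tight_cut_unshrink[OF wf U Z] unfolding tight_cuts_spanned_def by blast
  define h where "h v = (if s v then y v else - y v)" for v
  obtain x where x: "x \<in> U"
    using tight_cutD(4)[OF U] by blast
  have h: "h u = h x" if "u \<in> U" for u
  proof (rule tight_cut_shore_const[OF H U _ that x])
    fix f a b assume f: "f \<in> edges H" and ab: "ends H f = {a, b}" "a \<noteq> b" "a \<in> U" "b \<in> U"
    have "f \<notin> cut H ?Z"
      using in_cut_iff[OF f ab(1,2), of ?Z] wf_ugraph_endsD[OF wf f ab(1)] shrink_inside[OF ab(3,4)]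
      by (simp add: unshrink_def)
    moreover have "indicator (cut H ?Z) f = y a + y b"
      using y f ab(1,2) by simp
    ultimately have "y a + y b = 0"
      by simp
    then show "h a = h b"
      using bipartite_shoreD(1)[OF s f ab(1,3,4)] by (auto simp: h_def)
  qed
  define z where "z v = (if v \<in> U then h x else y v)" for v
  have "indicator (cut (contract H U) Z) f = sum z (ends (contract H U) f)"
    if f: "f \<in> edges (contract H U)" for f
  proof -
    obtain a b where ab: "f \<in> edges H" "ends H f = {a, b}" "a \<noteq> b" "a \<in> verts H" "b \<in> verts H"
      "b \<notin> U" "ends (contract H U) f = {shrink U a, b}" "shrink U a \<noteq> b"
      using contract_edgeE[OF wf f] .
    have "z (shrink U a) = y a"
    proof (cases "a \<in> U")
      case True
      then show ?thesis
        using h[OF True] bipartite_shoreD(2)[OF s ab(1,2) True ab(6)] shrink_in[OF True]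
        by (simp add: z_def h_def)
    qed (simp add: z_def)
    then show ?thesis
      using ab y by (simp add: cut_contract[OF wf] z_def)
  qed
  then show "\<exists>y :: _ \<Rightarrow> real. \<forall>f\<in>edges (contract H U).
      indicator (cut (contract H U) Z) f = sum y (ends (contract H U) f)"
    by blast
qed

section \<open>Assembling decompositions and counting their bricks\<close>

lemma tight_cut_steps_context:
  assumes "tight_cut_step\<^sup>*\<^sup>* Gs Hs"
  shows "tight_cut_step\<^sup>*\<^sup>* (xs @ Gs @ ys) (xs @ Hs @ ys)"
  using assms
proof induction
  case (step Hs Ks)
  from step.hyps(2) have "tight_cut_step (xs @ Hs @ ys) (xs @ Ks @ ys)"
  proof cases
    case (1 H U as bs)
    then show ?thesis
      using tight_cut_step.intros[OF 1(3), of "xs @ as" "bs @ ys"] by simp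
  qed
  then show ?case
    using step.IH by simp
qed simp

lemma tight_cut_decomposition_split:
  assumes "nontrivial_tight_cut H U"
    and "tight_cut_decomposition (contract H U) Gs"
    and "tight_cut_decomposition (contract H (verts H - U)) Hs"
  shows "tight_cut_decomposition H (Gs @ Hs)"
proof -
  have "tight_cut_step [H] [contract H U, contract H (verts H - U)]"
    using tight_cut_step.intros[OF assms(1), of "[]" "[]"] by simp
  also have "tight_cut_step\<^sup>*\<^sup>* [contract H U, contract H (verts H - U)] (Gs @ [contract H (verts H - U)])"
    using tight_cut_steps_context[of "[contract H U]" Gs "[]"] assms(2)
    by (simp add: tight_cut_decomposition_def)
  also have "tight_cut_step\<^sup>*\<^sup>* (Gs @ [contract H (verts H - U)]) (Gs @ Hs)"
    using tight_cut_steps_context[of "[contract H (verts H - U)]" Hs Gs "[]"] assms(3)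
    by (simp add: tight_cut_decomposition_def)
  finally show ?thesis
    using assms(2,3) by (auto simp: tight_cut_decomposition_def)
qed

lemma tight_cut_decomposition_trivial:
  "\<nexists>U. nontrivial_tight_cut H U \<Longrightarrow> tight_cut_decomposition H [H]"
  by (simp add: tight_cut_decomposition_def)

lemma nontrivial_tight_cut_card_less:
  assumes "wf_ugraph H" "nontrivial_tight_cut H U"
  shows "card (verts (contract H U)) < card (verts H)"
  using card_verts_contract_less[of H U] assms
  by (simp add: nontrivial_tight_cut_def tight_cut_def)

lemma bipartite_decomposition:
  assumes "matching_covered H" "bipartite H"
  shows "\<exists>Gs. tight_cut_decomposition H Gs \<and> filter brick Gs = []"
  using assms
proof (induction "card (verts H)" arbitrary: H rule: less_induct)
  case less
  note wf = matching_coveredD(1)[OF less.prems(1)]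
  show ?case
  proof (cases "\<exists>U. nontrivial_tight_cut H U")
    case False
    then have "tight_cut_decomposition H [H]"
      by (rule tight_cut_decomposition_trivial)
    moreover have "filter brick [H] = []"
      using less.prems(2) by (simp add: brick_def)
    ultimately show ?thesis
      by blast
  next
    case True
    have ex: "\<exists>Gs. tight_cut_decomposition (contract H U) Gs \<and> filter brick Gs = []"
      if U: "nontrivial_tight_cut H U" for U
    proof (rule less.hyps)
      show "card (verts (contract H U)) < card (verts H)"
        using nontrivial_tight_cut_card_less[OF wf U] .
      have "tight_cut H U"
        using U by (simp add: nontrivial_tight_cut_def)
      then show "matching_covered (contract H U)" "bipartite (contract H U)"
        using matching_covered_contract bipartite_contract less.prems by blast+
    qed
    obtain U where U: "nontrivial_tight_cut H U"
      using True by blast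
    obtain Gs Hs where
      "tight_cut_decomposition (contract H U) Gs" "filter brick Gs = []"
      "tight_cut_decomposition (contract H (verts H - U)) Hs" "filter brick Hs = []"
      using ex[OF U] ex[OF nontrivial_tight_cut_Compl[OF wf U]] by blast
    then show ?thesis
      using tight_cut_decomposition_split[OF U, of Gs Hs] by (intro exI[of _ "Gs @ Hs"]) simp
  qed
qed

text \<open>Since \<open>near_brick\<close> is witnessed by a single decomposition, the cut and the
  roles of its shores may be chosen at each stage. Contracting the bipartite shore inherits all
  three assumptions; contracting the other one gives a bipartite graph, which contributes no
  brick.\<close>

lemma spanned_decomposition:
  assumes "matching_covered H" "\<not> bipartite H" "tight_cuts_spanned H"
  shows "\<exists>Gs. tight_cut_decomposition H Gs \<and> length (filter brick Gs) = 1"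
  using assms
proof (induction "card (verts H)" arbitrary: H rule: less_induct)
  case less
  note wf = matching_coveredD(1)[OF less.prems(1)]
  show ?case
  proof (cases "\<exists>U. nontrivial_tight_cut H U")
    case False
    then have "tight_cut_decomposition H [H]"
      by (rule tight_cut_decomposition_trivial)
    moreover have "length (filter brick [H]) = 1"
      using less.prems(1,2) False by (simp add: brick_def)
    ultimately show ?thesis
      by blast
  next
    case True
    obtain V where V: "nontrivial_tight_cut H V"
      using True by blast
    then have "tight_cut H V"
      by (simp add: nontrivial_tight_cut_def)
    then obtain y :: "_ \<Rightarrow> real" where y: "\<forall>f\<in>edges H. indicator (cut H V) f = sum y (ends H f)"
      using less.prems(3) unfolding tight_cuts_spanned_def by blast
    \<comment> \<open>\<open>U\<close> is whichever shore of the cut of \<open>V\<close> turns out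
      to be bipartite.\<close>
    obtain U s where U: "nontrivial_tight_cut H U" and s: "bipartite_shore H U s"
      using potential_bipartite_shore[OF less.prems(1,2) \<open>tight_cut H V\<close> y]
        V nontrivial_tight_cut_Compl[OF wf V] by metis
    then have tU: "tight_cut H U"
      by (simp add: nontrivial_tight_cut_def)
    have "\<exists>Gs. tight_cut_decomposition (contract H U) Gs \<and> length (filter brick Gs) = 1"
    proof (rule less.hyps)
      show "card (verts (contract H U)) < card (verts H)"
        using nontrivial_tight_cut_card_less[OF wf U] .
      show "matching_covered (contract H U)"
        using matching_covered_contract[OF less.prems(1) tU] .
      show "\<not> bipartite (contract H U)"
        using bipartite_of_contract[OF less.prems(1) tU s] less.prems(2) by blast
      show "tight_cuts_spanned (contract H U)"
        using tight_cuts_spanned_contract[OF less.prems(1) tU s less.prems(3)] .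
    qed
    moreover have "\<exists>Hs. tight_cut_decomposition (contract H (verts H - U)) Hs \<and> filter brick Hs = []"
      using bipartite_decomposition[OF matching_covered_contract[OF less.prems(1) tight_cut_Compl[OF wf tU]]
        bipartite_contract_Compl[OF less.prems(1) tU s]] .
    ultimately obtain Gs Hs where
      "tight_cut_decomposition (contract H U) Gs" "length (filter brick Gs) = 1"
      "tight_cut_decomposition (contract H (verts H - U)) Hs" "filter brick Hs = []"
      by blast
    then show ?thesis
      using tight_cut_decomposition_split[OF U, of Gs Hs] by (intro exI[of _ "Gs @ Hs"]) simp
  qed
qed

lemma near_brickI:
  assumes "matching_covered H" "\<not> bipartite H" "PM_polytope H = P_polytope H"
  shows "near_brick H"
  using spanned_decomposition[OF assms(1,2) BvN_tight_cuts_spanned[OF assms(1,3)]] assms(1)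
  by (simp add: near_brick_def)


section \<open>Deleting edges\<close>

lemma delete_edge_simps [simp]:
  "verts (delete_edge G e) = verts G" "ends (delete_edge G e) = ends G"
  "edges (delete_edge G e) = edges G - {e}"
  by (simp_all add: delete_edge_def)

lemma wf_delete_edge: "wf_ugraph G \<Longrightarrow> wf_ugraph (delete_edge G e)"
  by (simp add: wf_ugraph_def)

lemma perfect_matching_delete_edge:
  "perfect_matching (delete_edge G e) M \<longleftrightarrow> perfect_matching G M \<and> e \<notin> M"
  by (auto simp: perfect_matching_def)

lemma P_polytope_delete_edge:
  assumes "x \<in> P_polytope (delete_edge G e)"
  shows "x \<in> P_polytope G" "x $ e = 0"
proof -
  show e: "x $ e = 0"
    using assms by (simp add: P_polytope_def)
  have "(\<Sum>f\<in>incident_edges G v. x $ f) = (\<Sum>f\<in>incident_edges (delete_edge G e) v. x $ f)" for v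
    by (rule sum.mono_neutral_cong_right) (use e in \<open>auto simp: incident_edges_def\<close>)
  then show "x \<in> P_polytope G"
    using assms e by (auto simp: P_polytope_def)
qed

lemma convex_hull_face:
  fixes S :: "'a::real_inner set"
  assumes S: "finite S" "\<And>v. v \<in> S \<Longrightarrow> a \<bullet> v \<ge> 0" and x: "x \<in> convex hull S" "a \<bullet> x = 0"
  shows "x \<in> convex hull {v \<in> S. a \<bullet> v = 0}"
proof -
  obtain u where u: "\<forall>v\<in>S. 0 \<le> u v" "sum u S = 1" "(\<Sum>v\<in>S. u v *\<^sub>R v) = x"
    using x(1) unfolding convex_hull_finite[OF S(1)] by blast
  have "(\<Sum>v\<in>S. u v * (a \<bullet> v)) = 0"
    using x(2) unfolding u(3)[symmetric] by (simp add: inner_sum_right)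
  moreover have "\<forall>v\<in>S. 0 \<le> u v * (a \<bullet> v)"
    using u(1) S(2) by simp
  ultimately have "\<forall>v\<in>S. u v * (a \<bullet> v) = 0"
    using sum_nonneg_eq_0_iff[OF S(1), of "\<lambda>v. u v * (a \<bullet> v)"] by simp
  then have z: "u v = 0" if "v \<in> S" "a \<bullet> v \<noteq> 0" for v
    using that by fastforce
  let ?T = "{v \<in> S. a \<bullet> v = 0}"
  have fin: "finite ?T"
    using S(1) by simp
  have "sum u S = sum u ?T"
    by (rule sum.mono_neutral_right[OF S(1)]) (use z in auto)
  moreover have "(\<Sum>v\<in>S. u v *\<^sub>R v) = (\<Sum>v\<in>?T. u v *\<^sub>R v)"
    by (rule sum.mono_neutral_right[OF S(1)]) (use z in auto)
  ultimately show ?thesis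
    unfolding convex_hull_finite[OF fin] using u by (intro CollectI exI[of _ u]) simp
qed

text \<open>Both polytopes of \<open>G - e\<close> are the faces with zero coordinate at
  \<open>e\<close> of the polytopes of \<open>G\<close>, and a face of a convex hull is spanned by
  the generators that lie on it.\<close>

lemma PM_eq_P_delete_edge:
  fixes G :: "('v, 'e::finite) ugraph"
  assumes wf: "wf_ugraph G" and PM: "PM_polytope G = P_polytope G"
  shows "PM_polytope (delete_edge G e) = P_polytope (delete_edge G e)"
proof
  show "PM_polytope (delete_edge G e) \<subseteq> P_polytope (delete_edge G e)"
    by (rule PM_subset_P[OF wf_delete_edge[OF wf]])
  show "P_polytope (delete_edge G e) \<subseteq> PM_polytope (delete_edge G e)"
  proof
    fix x assume x: "x \<in> P_polytope (delete_edge G e)"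
    let ?S = "incidence_vector ` {M. perfect_matching G M} :: (real ^ 'e) set"
    have "x \<in> convex hull {v \<in> ?S. axis e 1 \<bullet> v = 0}"
    proof (rule convex_hull_face)
      show "x \<in> convex hull ?S"
        using P_polytope_delete_edge(1)[OF x] PM by (simp add: PM_polytope_def)
      show "axis e 1 \<bullet> x = 0"
        using P_polytope_delete_edge(2)[OF x] by (simp add: inner_axis')
    qed (auto simp: inner_axis')
    also have "{v \<in> ?S. axis e 1 \<bullet> v = 0} = incidence_vector ` {M. perfect_matching (delete_edge G e) M}"
      by (auto simp: inner_axis' perfect_matching_delete_edge indicator_def split: if_splits)
    finally show "x \<in> PM_polytope (delete_edge G e)"
      by (simp add: PM_polytope_def)
  qed
qed

text \<open>An edge of the matching meets \<open>K\<close> in an odd number of vertices exactly when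
  it lies in the cut.\<close>

lemma odd_card_matching_cut:
  assumes wf: "wf_ugraph G" and M: "perfect_matching G M" and K: "K \<subseteq> verts G"
  shows "odd (card (M \<inter> cut G K)) \<longleftrightarrow> odd (card K)"
proof -
  have fin: "finite M"
    using M wf by (auto simp: perfect_matching_def wf_ugraph_def intro: finite_subset)
  have "odd (card (ends G f \<inter> K)) \<longleftrightarrow> f \<in> cut G K" if "f \<in> M" for f
  proof -
    have f: "f \<in> edges G"
      using M that by (auto simp: perfect_matching_def)
    obtain u v where uv: "ends G f = {u, v}" "u \<noteq> v" "u \<in> verts G" "v \<in> verts G"
      using wf_ugraph_edgeE[OF wf f] .
    then show ?thesis
      unfolding in_cut_iff[OF f uv(1,2)] uv(1) by (cases "u \<in> K"; cases "v \<in> K") simp_all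
  qed
  then have "{f \<in> M. odd (card (ends G f \<inter> K))} = M \<inter> cut G K"
    by auto
  then show ?thesis
    using perfect_matching_sum_card[OF wf M K] even_sum_iff[OF fin, of "\<lambda>f. card (ends G f \<inter> K)"]
    by simp
qed

text \<open>If \<open>G - e\<close> were bipartite, \<open>M0\<close> would show that its classes
  have equal size. In \<open>M1\<close> all edges but \<open>e\<close> are balanced, so
  \<open>e\<close> is balanced too and joins the two classes, which makes \<open>G\<close>
  bipartite.\<close>

lemma delete_edge_not_bipartite:
  fixes G :: "('v, 'e) ugraph"
  assumes wf: "wf_ugraph G" and G: "\<not> bipartite G" and e: "e \<in> edges G"
    and M0: "perfect_matching G M0" "e \<notin> M0" and M1: "perfect_matching G M1" "e \<in> M1"
  shows "\<not> bipartite (delete_edge G e)"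
proof
  assume bip: "bipartite (delete_edge G e)"
  obtain s :: "'v \<Rightarrow> bool" where
    s: "\<forall>f\<in>edges (delete_edge G e). \<forall>a b. ends (delete_edge G e) f = {a, b} \<longrightarrow> s a \<noteq> s b"
    using bipartiteE[OF bip] .
  define y :: "'v \<Rightarrow> int" where "y v = (if s v then 1 else - 1)" for v
  have col: "s a \<noteq> s b" if "f \<in> edges G" "f \<noteq> e" "ends G f = {a, b}" for f a b
    using bspec[OF s, of f] that by simp
  have y0: "sum y (ends G f) = 0" if f: "f \<in> edges G" "f \<noteq> e" for f
  proof -
    obtain a b where "ends G f = {a, b}" "a \<noteq> b" "a \<in> verts G" "b \<in> verts G"
      using wf_ugraph_edgeE[OF wf f(1)] .
    then show ?thesis
      using col[OF f] by (auto simp: y_def)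
  qed
  have sub: "M0 \<subseteq> edges G" "M1 \<subseteq> edges G" "finite M1"
    using M0 M1 wf by (auto simp: perfect_matching_def wf_ugraph_def intro: finite_subset)
  have "sum y (verts G) = (\<Sum>f\<in>M0. sum y (ends G f))"
    using perfect_matching_sum[OF wf M0(1), of y] by simp
  also have "\<dots> = 0"
    using y0 sub(1) M0(2) by (intro sum.neutral) blast
  finally have "(\<Sum>f\<in>M1. sum y (ends G f)) = 0"
    using perfect_matching_sum[OF wf M1(1), of y] by simp
  moreover have "(\<Sum>f\<in>M1 - {e}. sum y (ends G f)) = 0"
    using y0 sub(2) by (intro sum.neutral) blast
  ultimately have ye: "sum y (ends G e) = 0"
    using sum.remove[OF sub(3) M1(2), of "\<lambda>f. sum y (ends G f)"] by simp
  have "bipartite G"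
  proof (rule bipartiteI[OF wf])
    fix f a b assume f: "f \<in> edges G" "ends G f = {a, b}"
    show "s a \<noteq> s b"
    proof (cases "f = e")
      case True
      then show ?thesis
        using ye f wf_ugraph_endsD[OF wf f] by (auto simp: y_def split: if_splits)
    next
      case False
      then show ?thesis
        using col[OF f(1) _ f(2)] by blast
    qed
  qed
  then show False
    using G by blast
qed

lemma brickD:
  assumes "brick G"
  shows "matching_covered G" "\<not> bipartite G" "\<not> nontrivial_tight_cut G U"
  using assms by (auto simp: brick_def)

text \<open>If \<open>e\<close> were in every perfect matching, an edge sharing an end with
  \<open>e\<close> would have to be \<open>e\<close>, since it lies in some perfect matching. By
  connectivity the ends of \<open>e\<close> are then all the vertices, and \<open>G\<close> is
  bipartite.\<close>

lemma brick_avoiding: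
  assumes G: "brick G" and e: "e \<in> edges G"
  obtains M where "perfect_matching G M" "e \<notin> M"
proof (cases "\<exists>M. perfect_matching G M \<and> e \<notin> M")
  case True
  then show thesis
    using that by blast
next
  case False
  then have all: "e \<in> M" if "perfect_matching G M" for M
    using that by blast
  note mc = brickD(1)[OF G]
  note wf = matching_coveredD(1)[OF mc]
  obtain u v where uv: "ends G e = {u, v}" "u \<noteq> v" "u \<in> verts G" "v \<in> verts G"
    using wf_ugraph_edgeE[OF wf e] .
  have only: "g = e" if g: "g \<in> edges G" "w \<in> ends G g" "w \<in> ends G e" for g w
  proof -
    obtain M where M: "perfect_matching G M" "g \<in> M"
      using matching_coveredD(5)[OF mc g(1)] by blast
    show ?thesis
      using perfect_matching_unique[OF wf M(1,2) all[OF M(1)] g(2,3)] .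
  qed
  have "cut G {u, v} = {}"
  proof (rule ccontr)
    assume "cut G {u, v} \<noteq> {}"
    then obtain g where g: "g \<in> cut G {u, v}"
      by blast
    then have "card (ends G g \<inter> ends G e) = 1" and ge: "g \<in> edges G"
      unfolding uv(1) by (simp_all add: cut_def)
    then have "ends G g \<inter> ends G e \<noteq> {}"
      by auto
    then have "g = e"
      using only[OF ge] by blast
    then show False
      using g uv by (simp add: cut_def)
  qed
  then have V: "verts G = {u, v}"
    using iffD1[OF connected_ugraph_iff_cut[OF wf] matching_coveredD(3)[OF mc], rule_format, of "{u, v}"] uv
    by auto
  have "bipartite G"
  proof (rule bipartiteI[OF wf])
    fix f a b assume f: "f \<in> edges G" "ends G f = {a, b}"
    then show "(a = u) \<noteq> (b = u)"
      using wf_ugraph_endsD[OF wf f] V by auto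
  qed
  then show thesis
    using brickD(2)[OF G] by blast
qed


section \<open>Equivalent edges of a brick\<close>

text \<open>A matching with \<open>e\<close> and \<open>f\<close> covers \<open>u\<close> by
  \<open>e\<close> and leaves \<open>K - {u}\<close> through \<open>f\<close> alone. A matching
  without them does not cross \<open>K\<close>, so it leaves \<open>K - {u}\<close> only through its
  edge at \<open>u\<close>. Oddness of the shores follows from this count.\<close>

lemma equivalent_two_cut_tight:
  assumes wf: "wf_ugraph G" and even: "even (card (verts G))"
    and dep: "\<And>M. perfect_matching G M \<Longrightarrow> e \<in> M \<longleftrightarrow> f \<in> M"
    and K: "K \<subseteq> verts G" "cut G K = {e, f}"
    and M0: "perfect_matching G M0"
    and e: "ends G e = {u, w}" "u \<in> K" "w \<notin> K"
    and f: "u \<notin> ends G f"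
  shows "tight_cut G (K - {u})"
proof -
  have ef: "e \<in> edges G" "f \<in> edges G"
    using K(2) by (auto simp: cut_def)
  have count: "card (M \<inter> cut G (K - {u})) = 1" if M: "perfect_matching G M" for M
  proof -
    have sub: "M \<subseteq> edges G"
      using M by (simp add: perfect_matching_def)
    have u: "u \<in> verts G"
      using K(1) e by blast
    have "\<exists>h. M \<inter> cut G (K - {u}) = {h}"
    proof (cases "e \<in> M")
      case True
      then have fM: "f \<in> M"
        using dep[OF M] by simp
      obtain p q where pq: "ends G f = {p, q}" "p \<noteq> q" "p \<in> verts G" "q \<in> verts G"
        using wf_ugraph_edgeE[OF wf ef(2)] .
      have "(p \<in> K) \<noteq> (q \<in> K)"
        using in_cut_iff[OF ef(2) pq(1,2), of K] K(2) by simp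
      then have fin: "f \<in> cut G (K - {u})"
        unfolding in_cut_iff[OF ef(2) pq(1,2)] using f pq(1) by auto
      have "g = f" if g: "g \<in> M" "g \<in> cut G (K - {u})" for g
      proof (rule ccontr)
        assume "g \<noteq> f"
        have ge: "g \<in> edges G"
          using g sub by blast
        obtain a b where ab: "ends G g = {a, b}" "a \<noteq> b" "a \<in> verts G" "b \<in> verts G"
          using wf_ugraph_edgeE[OF wf ge] .
        have gK: "(a \<in> K - {u}) \<noteq> (b \<in> K - {u})"
          using g(2) unfolding in_cut_iff[OF ge ab(1,2)] .
        have "g \<noteq> e"
          using gK e ab(1) by (auto simp: doubleton_eq_iff)
        then have "g \<notin> cut G K"
          using \<open>g \<noteq> f\<close> K(2) by simp
        then have "(a \<in> K) = (b \<in> K)"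
          unfolding in_cut_iff[OF ge ab(1,2)] by blast
        then have "u \<in> ends G g"
          using gK ab(1) by auto
        moreover have "u \<in> ends G e"
          using e(1) by simp
        ultimately show False
          using perfect_matching_unique[OF wf M g(1) True] \<open>g \<noteq> e\<close> by blast
      qed
      then have "M \<inter> cut G (K - {u}) = {f}"
        using fM fin by blast
      then show ?thesis
        by blast
    next
      case False
      then have fM: "f \<notin> M"
        using dep[OF M] by simp
      have inner: "(a \<in> K) = (b \<in> K)" if g: "g \<in> M" "ends G g = {a, b}" for g a b
      proof -
        have ge: "g \<in> edges G"
          using g(1) sub by blast
        have "g \<notin> cut G K"
          using g False fM K(2) by auto
        then show ?thesis
          using in_cut_iff[OF ge g(2), of K] wf_ugraph_endsD(1)[OF wf ge g(2)] by blast
      qed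
      obtain h where h: "h \<in> M" "u \<in> ends G h" "h \<in> edges G"
        using perfect_matching_edge_at[OF M u] .
      have iff: "g \<in> cut G (K - {u}) \<longleftrightarrow> u \<in> ends G g" if g: "g \<in> M" for g
      proof -
        have ge: "g \<in> edges G"
          using g sub by blast
        obtain a b where ab: "ends G g = {a, b}" "a \<noteq> b" "a \<in> verts G" "b \<in> verts G"
          using wf_ugraph_edgeE[OF wf ge] .
        show ?thesis
          unfolding in_cut_iff[OF ge ab(1,2)] using inner[OF g ab(1)] ab(1,2) e(2) by auto
      qed
      have "M \<inter> cut G (K - {u}) = {h}"
        using h iff perfect_matching_unique[OF wf M _ h(1) _ h(2)] by blast
      then show ?thesis
        by blast
    qed
    then show ?thesis
      by auto
  qed
  have odd: "odd (card (K - {u}))"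
    using odd_card_matching_cut[OF wf M0, of "K - {u}"] count[OF M0] K(1) by auto
  have "finite (verts G)"
    using wf by (simp add: wf_ugraph_def)
  then have "card (verts G - (K - {u})) = card (verts G) - card (K - {u})"
    "card (K - {u}) \<le> card (verts G)"
    using K(1) by (auto intro!: card_Diff_subset card_mono intro: finite_subset)
  then have "odd (card (verts G - (K - {u})))"
    using odd even by simp
  then show ?thesis
    unfolding tight_cut_def using odd count K(1) by auto
qed

text \<open>In other words, \<open>G - e - f\<close> is connected. Comparing a matching without the
  two edges to one with both shows that the cut has an even number of edges, so it is
  \<open>{e, f}\<close>. Taking an end of \<open>e\<close> off either shore gives a tight cut; as it
  must be trivial, both shores have two vertices, and \<open>G\<close> is bipartite.\<close>

lemma brick_equivalent_edges_cut:
  assumes G: "brick G" and ef: "e \<in> edges G" "f \<in> edges G" "e \<noteq> f"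
    and dep: "\<And>M. perfect_matching G M \<Longrightarrow> e \<in> M \<longleftrightarrow> f \<in> M"
    and K: "K \<subseteq> verts G" "cut G K \<subseteq> {e, f}" "K \<noteq> {}"
  shows "K = verts G"
proof (rule ccontr)
  assume "K \<noteq> verts G"
  note mc = brickD(1)[OF G]
  note wf = matching_coveredD(1)[OF mc]
  have finV: "finite (verts G)"
    using wf by (simp add: wf_ugraph_def)
  obtain M0 where M0: "perfect_matching G M0" "e \<notin> M0"
    using brick_avoiding[OF G ef(1)] .
  have "M0 \<inter> cut G K = {}"
    using K(2) M0 dep by blast
  then have evenK: "even (card K)"
    using odd_card_matching_cut[OF wf M0(1) K(1)] by simp
  obtain M1 where M1: "perfect_matching G M1" "e \<in> M1"
    using matching_coveredD(5)[OF mc ef(1)] by blast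
  then have fM1: "f \<in> M1"
    using dep by blast
  have sub1: "M1 \<inter> cut G K = cut G K"
    using K(2) M1(2) fM1 by blast
  have "cut G K \<noteq> {}"
    using iffD1[OF connected_ugraph_iff_cut[OF wf] matching_coveredD(3)[OF mc], rule_format, of K]
      K \<open>K \<noteq> verts G\<close> by blast
  moreover have "even (card (cut G K))"
    using odd_card_matching_cut[OF wf M1(1) K(1)] evenK sub1 by simp
  then have "cut G K \<noteq> {e}" "cut G K \<noteq> {f}"
    by auto
  ultimately have cutK: "cut G K = {e, f}"
    using K(2) by blast
  obtain u w where uw: "ends G e = {u, w}" "u \<in> K" "w \<in> verts G - K"
  proof -
    obtain a b where ab: "ends G e = {a, b}" "a \<noteq> b" "a \<in> verts G" "b \<in> verts G"
      using wf_ugraph_edgeE[OF wf ef(1)] .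
    then show thesis
      using that[of a b] that[of b a] in_cut_iff[OF ef(1) ab(1,2), of K] cutK
      by (auto simp: insert_commute)
  qed
  obtain p q where pq: "ends G f = {p, q}" "p \<in> K" "q \<in> verts G - K"
  proof -
    obtain a b where ab: "ends G f = {a, b}" "a \<noteq> b" "a \<in> verts G" "b \<in> verts G"
      using wf_ugraph_edgeE[OF wf ef(2)] .
    then show thesis
      using that[of a b] that[of b a] in_cut_iff[OF ef(2) ab(1,2), of K] cutK
      by (auto simp: insert_commute)
  qed
  have disj: "v \<notin> ends G f" if "v \<in> ends G e" for v
    using perfect_matching_unique[OF wf M1(1,2) fM1 that] ef(3) by blast
  \<comment> \<open>Formulated for a shore \<open>L\<close> left by \<open>e\<close> from
    \<open>u'\<close> to \<open>w'\<close>, so as to serve both shores. The two vertices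
    \<open>w'\<close> and \<open>p'\<close> outside make the complement large, so
    \<open>L - {u'}\<close> must be a single vertex.\<close>
  have size: "card L = 2"
    if L: "L \<subseteq> verts G" "L = K \<or> L = verts G - K" "u' \<in> L" "ends G e = {u', w'}" "w' \<in> verts G - L"
      "p' \<in> verts G - L" "p' \<noteq> w'" for L u' w' p'
  proof (rule ccontr)
    assume "card L \<noteq> 2"
    have cutL: "cut G L = {e, f}"
      using L(2) cutK cut_Compl[OF wf, of K] by auto
    have tight: "tight_cut G (L - {u'})"
      by (rule equivalent_two_cut_tight[OF wf matching_coveredD(2)[OF mc] dep L(1) cutL M0(1) L(4,3)])
        (use L disj in auto)
    have finL: "finite L"
      using L(1) finV by (rule finite_subset)
    have "card L = Suc (card (L - {u'}))"
      using finL L(3) by (rule card.remove)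
    moreover have "odd (card (L - {u'}))"
      using tight_cutD(2)[OF tight] .
    ultimately have "card (L - {u'}) > 1"
      using \<open>card L \<noteq> 2\<close> by (cases "card (L - {u'})") auto
    moreover have "card {w', p'} \<le> card (verts G - (L - {u'}))"
      using L finV by (intro card_mono) auto
    then have "card (verts G - (L - {u'})) > 1"
      using L(7) by simp
    ultimately show False
      using brickD(3)[OF G] tight by (auto simp: nontrivial_tight_cut_def)
  qed
  have neq: "u \<noteq> p" "w \<noteq> q"
    using disj uw(1) pq(1) by auto
  have "card K = 2"
    using size[of K u w q] K(1) uw pq neq by simp
  then have Kset: "K = {u, p}"
    using uw(2) pq(2) neq finite_subset[OF K(1) finV] card_seteq[of K "{u, p}"] by simp
  have "card (verts G - K) = 2"
    using size[of "verts G - K" w u p] K(1) uw pq neq by (auto simp: insert_commute)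
  then have Lset: "verts G - K = {w, q}"
    using uw(3) pq(3) neq finV card_seteq[of "verts G - K" "{w, q}"] by simp
  have "bipartite G"
  proof (rule bipartiteI[OF wf])
    fix g a b assume g: "g \<in> edges G" "ends G g = {a, b}"
    note ab = wf_ugraph_endsD[OF wf g]
    have "w \<notin> {u, p}" "q \<notin> {u, p}"
      using uw(3) pq(3) Kset by auto
    consider "g = e" | "g = f" | "g \<notin> cut G K"
      using cutK by blast
    \<comment> \<open>The edges across the cut are \<open>uw\<close> and \<open>pq\<close>, all
      others lie inside \<open>{u, p}\<close> or \<open>{w, q}\<close>. Up to multiplicities this is
      part of a 4-cycle in which \<open>u\<close> and \<open>q\<close> are opposite.\<close>
    then show "(a = u \<or> a = q) \<noteq> (b = u \<or> b = q)"
    proof cases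
      case 1
      then show ?thesis
        using g(2) uw(1) neq \<open>w \<notin> {u, p}\<close> \<open>q \<notin> {u, p}\<close> by (auto simp: doubleton_eq_iff)
    next
      case 2
      then show ?thesis
        using g(2) pq(1) neq \<open>w \<notin> {u, p}\<close> \<open>q \<notin> {u, p}\<close> by (auto simp: doubleton_eq_iff)
    next
      case 3
      then have "(a \<in> K) = (b \<in> K)"
        using in_cut_iff[OF g ab(1), of K] by blast
      then have "a \<in> {u, p} \<and> b \<in> {u, p} \<or> a \<in> {w, q} \<and> b \<in> {w, q}"
        using ab(2,3) Kset Lset by blast
      then show ?thesis
        using ab(1) neq \<open>w \<notin> {u, p}\<close> \<open>q \<notin> {u, p}\<close> by auto
    qed
  qed
  then show False
    using brickD(2)[OF G] by blast
qed

text \<open>The potential changes sign along all edges but \<open>e\<close> and \<open>f\<close>,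
  and \<open>G - e - f\<close> is connected, so its absolute value is constant. The ends of
  \<open>f\<close> have values of equal size adding up to 1.\<close>

lemma equivalent_edges_potential_abs:
  fixes y :: "'v \<Rightarrow> real"
  assumes G: "brick G" and ef: "e \<in> edges G" "f \<in> edges G" "e \<noteq> f"
    and dep: "\<And>M. perfect_matching G M \<Longrightarrow> e \<in> M \<longleftrightarrow> f \<in> M"
    and y: "\<And>g. g \<in> edges G \<Longrightarrow> sum y (ends G g) = indicator {f} g - indicator {e} g"
    and v: "v \<in> verts G"
  shows "\<bar>y v\<bar> = 1 / 2"
proof -
  note wf = matching_coveredD(1)[OF brickD(1)[OF G]]
  obtain p q where pq: "ends G f = {p, q}" "p \<noteq> q" "p \<in> verts G" "q \<in> verts G"
    using wf_ugraph_edgeE[OF wf ef(2)] .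
  define K where "K = {v \<in> verts G. \<bar>y v\<bar> = \<bar>y p\<bar>}"
  have "g \<in> {e, f}" if g: "g \<in> cut G K" for g
  proof (rule ccontr)
    assume neq: "g \<notin> {e, f}"
    have ge: "g \<in> edges G"
      using g by (simp add: cut_def)
    obtain a b where ab: "ends G g = {a, b}" "a \<noteq> b" "a \<in> verts G" "b \<in> verts G"
      using wf_ugraph_edgeE[OF wf ge] .
    have "y a + y b = 0"
      using y[OF ge] ab neq by simp
    then have "\<bar>y a\<bar> = \<bar>y b\<bar>"
      by linarith
    then show False
      using g ab(3,4) unfolding in_cut_iff[OF ge ab(1,2)] by (simp add: K_def)
  qed
  then have "K = verts G"
    using pq(3) by (intro brick_equivalent_edges_cut[OF G ef dep]) (auto simp: K_def)
  then have "\<bar>y v\<bar> = \<bar>y p\<bar>" "\<bar>y q\<bar> = \<bar>y p\<bar>"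
    using v pq(4) by (auto simp: K_def)
  moreover have "y p + y q = 1"
    using y[OF ef(2)] pq ef(3) by simp
  ultimately show ?thesis
    by linarith
qed

lemma equivalent_edges_potential:
  fixes G :: "('v, 'e::finite) ugraph"
  assumes wf: "wf_ugraph G"
    and cov: "\<And>f. f \<in> edges G \<Longrightarrow> \<exists>M. perfect_matching G M \<and> f \<in> M"
    and PM: "PM_polytope G = P_polytope G"
    and dep: "\<And>M. perfect_matching G M \<Longrightarrow> e \<in> M \<longleftrightarrow> f \<in> M"
  obtains y :: "'v \<Rightarrow> real" where
    "\<forall>g\<in>edges G. indicator {f} g - indicator {e} g = sum y (ends G g)"
proof (rule BvN_potential[OF wf cov PM])
  fix M assume M: "perfect_matching G M"
  have "finite M"
    by simp
  then show "(\<Sum>g\<in>M. indicator {f} g - indicator {e} g) = (0 :: real)"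
    using dep[OF M] by (simp add: sum_subtractf indicator_def[abs_def] of_bool_def sum.If_cases Int_def)
qed

lemma equivalent_edges_bipartite:
  fixes G :: "('v, 'e::finite) ugraph"
  assumes G: "brick G" and PM: "PM_polytope G = P_polytope G"
    and ef: "e \<in> edges G" "f \<in> edges G" "e \<noteq> f"
    and dep: "\<And>M. perfect_matching G M \<Longrightarrow> e \<in> M \<longleftrightarrow> f \<in> M"
  shows "bipartite (delete_edge (delete_edge G e) f)"
proof -
  note mc = brickD(1)[OF G]
  note wf = matching_coveredD(1)[OF mc]
  obtain y :: "'v \<Rightarrow> real" where y: "\<forall>g\<in>edges G. indicator {f} g - indicator {e} g = sum y (ends G g)"
    using equivalent_edges_potential[OF wf matching_coveredD(5)[OF mc] PM dep] .
  have abs: "\<bar>y v\<bar> = 1 / 2" if "v \<in> verts G" for v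
    by (rule equivalent_edges_potential_abs[OF G ef dep _ that]) (use y in auto)
  show ?thesis
  proof (rule bipartiteI[OF wf_delete_edge[OF wf_delete_edge[OF wf]]])
    fix g a b assume g: "g \<in> edges (delete_edge (delete_edge G e) f)"
      and ab: "ends (delete_edge (delete_edge G e) f) g = {a, b}"
    have ge: "g \<in> edges G" "ends G g = {a, b}"
      using g ab by simp_all
    have "y a + y b = 0"
      using bspec[OF y ge(1)] ge wf_ugraph_endsD[OF wf ge] g by simp
    then show "(y a > 0) \<noteq> (y b > 0)"
      using abs[of a] abs[of b] wf_ugraph_endsD[OF wf ge] by auto
  qed
qed

text \<open>With two partners, any two of \<open>e\<close>, \<open>f\<close> and \<open>f'\<close>
  would be equivalent. Then \<open>y\<close>, \<open>y'\<close> and their difference would all have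
  absolute value 1/2, but the difference of two such numbers is 0, 1 or -1.\<close>

lemma equivalent_edge_unique:
  fixes G :: "('v, 'e::finite) ugraph"
  assumes G: "brick G" and PM: "PM_polytope G = P_polytope G"
    and ef: "e \<in> edges G" "f \<in> edges G" "e \<noteq> f" "f' \<in> edges G" "e \<noteq> f'"
    and dep: "\<And>M. perfect_matching G M \<Longrightarrow> e \<in> M \<longleftrightarrow> f \<in> M"
    and dep': "\<And>M. perfect_matching G M \<Longrightarrow> e \<in> M \<longleftrightarrow> f' \<in> M"
  shows "f = f'"
proof (rule ccontr)
  assume neq: "f \<noteq> f'"
  note mc = brickD(1)[OF G]
  note wf = matching_coveredD(1)[OF mc]
  obtain y :: "'v \<Rightarrow> real" where y: "\<forall>g\<in>edges G. indicator {f} g - indicator {e} g = sum y (ends G g)"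
    using equivalent_edges_potential[OF wf matching_coveredD(5)[OF mc] PM dep] .
  obtain y' :: "'v \<Rightarrow> real" where y': "\<forall>g\<in>edges G. indicator {f'} g - indicator {e} g = sum y' (ends G g)"
    using equivalent_edges_potential[OF wf matching_coveredD(5)[OF mc] PM dep'] .
  obtain a b where ab: "ends G e = {a, b}" "a \<noteq> b" "a \<in> verts G" "b \<in> verts G"
    using wf_ugraph_edgeE[OF wf ef(1)] .
  have "\<bar>y a\<bar> = 1 / 2"
    by (rule equivalent_edges_potential_abs[OF G ef(1-3) dep _ ab(3)]) (use y in auto)
  moreover have "\<bar>y' a\<bar> = 1 / 2"
    by (rule equivalent_edges_potential_abs[OF G ef(1,4,5) dep' _ ab(3)]) (use y' in auto)
  moreover have "\<bar>y a - y' a\<bar> = 1 / 2"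
  proof (rule equivalent_edges_potential_abs[OF G ef(4,2) neq[symmetric] _ _ ab(3), where y = "\<lambda>v. y v - y' v"])
    show "f' \<in> M \<longleftrightarrow> f \<in> M" if "perfect_matching G M" for M
      using dep[OF that] dep'[OF that] by blast
    show "(\<Sum>v\<in>ends G g. y v - y' v) = indicator {f} g - indicator {f'} g" if "g \<in> edges G" for g
      using bspec[OF y that] bspec[OF y' that] by (simp add: sum_subtractf)
  qed
  ultimately show False
    by linarith
qed


section \<open>Alternating paths\<close>

definition star_sum :: "('v, 'e) ugraph \<Rightarrow> ('e \<Rightarrow> real) \<Rightarrow> 'v \<Rightarrow> real" where
  "star_sum G d v = (\<Sum>f\<in>incident_edges G v. d f)"

lemma star_sum_add: "star_sum G (\<lambda>f. c f + d f) v = star_sum G c v + star_sum G d v"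
  by (simp add: star_sum_def sum.distrib)

lemma star_sum_diff: "star_sum G (\<lambda>f. c f - d f) v = star_sum G c v - star_sum G d v"
  by (simp add: star_sum_def sum_subtractf)

lemma star_sum_scale: "star_sum G (\<lambda>f. r * d f) v = r * star_sum G d v"
  by (simp add: star_sum_def sum_distrib_left)

lemma star_sum_edge:
  assumes "wf_ugraph G" "h \<in> edges G" "ends G h = {a, b}"
  shows "star_sum G (indicator {h}) v = indicator {a} v + indicator {b} v"
proof -
  have "finite (incident_edges G v)"
    using assms(1) by (simp add: incident_edges_def wf_ugraph_def)
  then have "star_sum G (indicator {h}) v = (if h \<in> incident_edges G v then 1 else 0)"
    unfolding star_sum_def by (simp add: indicator_def[abs_def] of_bool_def sum.delta)
  then show ?thesis
    using assms(2,3) wf_ugraph_endsD[OF assms] by (auto simp: incident_edges_def)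
qed

text \<open>The coordinate at \<open>g\<close> is at most the one at \<open>e\<close> on the whole
  polytope. Both vanish at \<open>M0\<close>, so a direction leading from \<open>M0\<close> into the
  polytope inherits the inequality. Feasibility only restricts the signs outside
  \<open>M0\<close>.\<close>

lemma perturbed_matching_le:
  fixes G :: "('v, 'e::finite) ugraph"
  assumes wf: "wf_ugraph G" and PM: "PM_polytope G = P_polytope G"
    and dep: "\<And>M. perfect_matching G M \<Longrightarrow> g \<in> M \<Longrightarrow> e \<in> M"
    and M0: "perfect_matching G M0" "g \<notin> M0" "e \<notin> M0"
    and supp: "\<And>f. f \<notin> edges G \<Longrightarrow> d f = 0"
    and pos: "\<And>f. f \<notin> M0 \<Longrightarrow> d f \<ge> 0"
    and star: "\<And>v. v \<in> verts G \<Longrightarrow> star_sum G d v = 0"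
  shows "d g \<le> d e"
proof -
  obtain t where t: "t > 0" "incidence_vector M0 + t *\<^sub>R (\<chi> f. d f) \<in> P_polytope G"
  proof (rule P_polytope_perturb)
    show "incidence_vector M0 \<in> P_polytope G"
      by (rule incidence_vector_in_P[OF wf M0(1)])
    show "(\<Sum>f\<in>incident_edges G v. (\<chi> f. d f) $ f) = 0" if "v \<in> verts G" for v
      using star[OF that] by (simp add: star_sum_def)
    show "(\<chi> f. d f) $ f \<ge> 0" if "f \<in> edges G" "incidence_vector M0 $ f = 0" for f
      using pos[of f] that(2) by (simp add: indicator_def split: if_splits)
  qed (use supp in simp_all)
  have "(axis g 1 - axis e 1) \<bullet> (incidence_vector M0 + t *\<^sub>R (\<chi> f. d f)) \<le> 0"
  proof (rule PM_polytope_le[of G])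
    fix M assume M: "perfect_matching G M"
    show "(axis g 1 - axis e 1) \<bullet> incidence_vector M \<le> (0 :: real)"
      using dep[OF M] by (simp add: inner_diff_left inner_axis' indicator_def)
  qed (use t(2) PM in simp)
  then have "t * (d g - d e) \<le> 0"
    using M0(2,3) by (simp add: inner_diff_left inner_axis' algebra_simps)
  then show ?thesis
    using t(1) by (simp add: mult_le_0_iff)
qed

text \<open>A step goes from \<open>a\<close> along an arbitrary edge outside \<open>R\<close> to
  \<open>b\<close>, and on along the edge of \<open>M\<close> at \<open>b\<close>; paths thus stay
  in the class \<open>s\<close>. The choice \<open>h = k\<close> gives a harmless step from
  \<open>a\<close> to itself.\<close>

definition alternating_step ::
    "('v, 'e) ugraph \<Rightarrow> 'e set \<Rightarrow> 'e set \<Rightarrow> ('v \<Rightarrow> bool) \<Rightarrow> 'v \<Rightarrow> 'v \<Rightarrow> bool" where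
  "alternating_step G R M s a a' \<longleftrightarrow> s a \<and> s a' \<and>
     (\<exists>h\<in>edges G - R. \<exists>k\<in>M. \<exists>b. ends G h = {a, b} \<and> ends G k = {a', b})"

text \<open>Each step adds 1 on \<open>h\<close> and subtracts 1 on \<open>k\<close>: the
  contributions at \<open>b\<close> cancel and those at the inner vertices telescope. Repeated
  vertices and edges do no harm, because decreases hit edges of \<open>M\<close> only.\<close>

lemma alternating_path_vector:
  fixes G :: "('v, 'e) ugraph"
  assumes wf: "wf_ugraph G" and M: "M \<subseteq> edges G - R"
    and path: "(alternating_step G R M s)\<^sup>*\<^sup>* a a'"
  shows "\<exists>d. (\<forall>f. f \<notin> edges G - R \<longrightarrow> d f = 0) \<and> (\<forall>f. f \<notin> M \<longrightarrow> d f \<ge> 0) \<and>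
    (\<forall>v. star_sum G d v = indicator {a} v - indicator {a'} v)"
  using path
proof induction
  case base
  show ?case
    by (intro exI[of _ "\<lambda>_. 0"]) (simp add: star_sum_def)
next
  case (step a' a'')
  obtain d where "(\<forall>f. f \<notin> edges G - R \<longrightarrow> d f = 0) \<and> (\<forall>f. f \<notin> M \<longrightarrow> d f \<ge> 0) \<and>
      (\<forall>v. star_sum G d v = indicator {a} v - indicator {a'} v)"
    using step.IH ..
  then have d: "\<And>f. f \<notin> edges G - R \<Longrightarrow> d f = 0" "\<And>f. f \<notin> M \<Longrightarrow> d f \<ge> 0"
    "\<And>v. star_sum G d v = indicator {a} v - indicator {a'} v"
    by simp_all
  obtain h k b where hk: "h \<in> edges G - R" "k \<in> M" "ends G h = {a', b}" "ends G k = {a'', b}"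
    using step.hyps(2) unfolding alternating_step_def by blast
  have he: "h \<in> edges G" and ke: "k \<in> edges G"
    using hk M by auto
  define c where "c f = d f + (indicator {h} f - indicator {k} f)" for f
  have "star_sum G c v = indicator {a} v - indicator {a''} v" for v
    using d(3)[of v] star_sum_edge[OF wf he hk(3), of v] star_sum_edge[OF wf ke hk(4), of v]
    unfolding c_def star_sum_add star_sum_diff by simp
  moreover have "c f = 0" if "f \<notin> edges G - R" for f
    using d(1)[OF that] hk(1,2) M that by (auto simp: c_def indicator_def)
  moreover have "c f \<ge> 0" if "f \<notin> M" for f
    using d(2)[OF that] hk(2) that by (auto simp: c_def indicator_def)
  ultimately show ?case
    by (intro exI[of _ c]) simp
qed

section \<open>Deleting a pair of equivalent edges\<close>

text \<open>The normal form of the second case: with respect to the bipartition of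
  \<open>G - e - f\<close>, the edge \<open>e\<close> lies inside the class \<open>s\<close> and
  \<open>f\<close> inside the other class. A matching containing both remains balanced.\<close>

locale bipartite_pair =
  fixes G :: "('v, 'e::finite) ugraph" and e f :: 'e and s :: "'v \<Rightarrow> bool" and M0 :: "'e set"
    and a1 a2 b1 b2 :: 'v
  assumes brick: "brick G" and PM: "PM_polytope G = P_polytope G"
    and edges: "e \<in> edges G" "f \<in> edges G" "e \<noteq> f"
    and dep: "\<And>M. perfect_matching G M \<Longrightarrow> e \<in> M \<longleftrightarrow> f \<in> M"
    and col: "\<And>h a b. h \<in> edges G - {e, f} \<Longrightarrow> ends G h = {a, b} \<Longrightarrow> s a \<noteq> s b"
    and ends_e: "ends G e = {a1, a2}" "s a1" "s a2"
    and ends_f: "ends G f = {b1, b2}" "\<not> s b1" "\<not> s b2"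
    and M0: "perfect_matching G M0" "e \<notin> M0"
begin

lemma wf: "wf_ugraph G"
  using brick by (simp add: brick_def matching_covered_def)

lemma M0_sub: "M0 \<subseteq> edges G - {e, f}"
  using M0 dep[OF M0(1)] by (auto simp: perfect_matching_def)

lemma coloured_edgeE:
  assumes "h \<in> edges G - {e, f}"
  obtains a b where "ends G h = {a, b}" "s a" "\<not> s b" "a \<in> verts G" "b \<in> verts G"
proof -
  have "h \<in> edges G"
    using assms by simp
  then obtain a b where ab: "ends G h = {a, b}" "a \<noteq> b" "a \<in> verts G" "b \<in> verts G"
    by (rule wf_ugraph_edgeE[OF wf])
  then show thesis
    using that[of a b] that[of b a] col[OF assms ab(1)] by (cases "s a") (auto simp: insert_commute)
qed

text \<open>Exchanging \<open>e\<close> with \<open>f\<close> and reversing the colours is a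
  symmetry; it supplies the mirror image of \<open>not_split\<close>.\<close>

lemma flip: "bipartite_pair G f e (\<lambda>v. \<not> s v) M0 b1 b2 a1 a2"
  using brick PM edges dep col ends_e ends_f M0 unfolding bipartite_pair_def by blast

text \<open>A pair that is tight in the sense of Hall: \<open>T\<close> contains all neighbours of
  \<open>S\<close> in \<open>G - e - f\<close>, and \<open>M0\<close> matches \<open>S\<close> with
  \<open>T\<close>, so both have the same size.\<close>

definition closed_pair :: "'v set \<Rightarrow> 'v set \<Rightarrow> bool" where
  "closed_pair S T \<longleftrightarrow> (\<forall>v\<in>S. s v) \<and> (\<forall>v\<in>T. \<not> s v) \<and> S \<subseteq> verts G \<and> T \<subseteq> verts G \<and>
     (\<forall>h\<in>edges G - {e, f}. \<forall>a b. ends G h = {a, b} \<longrightarrow> s a \<longrightarrow>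
       (a \<in> S \<longrightarrow> b \<in> T) \<and> (h \<in> M0 \<longrightarrow> b \<in> T \<longrightarrow> a \<in> S))"

lemma closed_pairD:
  assumes "closed_pair S T" "h \<in> edges G - {e, f}" "ends G h = {a, b}" "s a"
  shows "a \<in> S \<Longrightarrow> b \<in> T" "h \<in> M0 \<Longrightarrow> b \<in> T \<Longrightarrow> a \<in> S"
  using assms unfolding closed_pair_def by blast+

lemma closed_pair_sub:
  assumes "closed_pair S T"
  shows "v \<in> S \<Longrightarrow> s v" "v \<in> T \<Longrightarrow> \<not> s v" "S \<subseteq> verts G" "T \<subseteq> verts G"
  using assms unfolding closed_pair_def by blast+

text \<open>
  Sum the indicator of \<open>S\<close> minus that of \<open>T\<close> over the ends of a perfect matching: the total is the
  same for every perfect matching, and it is \<open>0\<close> for \<open>M0\<close>.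
\<close>

lemma crossing_count:
  assumes ST: "closed_pair S T" and M: "perfect_matching G M"
  shows "int (card {h \<in> M - {e, f}. ends G h \<inter> S = {} \<and> ends G h \<inter> T \<noteq> {}}) =
    (if e \<in> M then of_bool (a1 \<in> S) + of_bool (a2 \<in> S) - of_bool (b1 \<in> T) - of_bool (b2 \<in> T) else 0)"
proof -
  \<comment> \<open>Edges other than \<open>e\<close> and \<open>f\<close> have weight 0, except
    that an edge entering \<open>T\<close> from outside \<open>S\<close> has weight -1. So the
    crossings of a matching are counted by what \<open>e\<close> and \<open>f\<close>
    contribute.\<close>
  define y :: "'v \<Rightarrow> int" where "y v = of_bool (v \<in> S) - of_bool (v \<in> T)" for v
  have y: "sum y (ends G h) = - of_bool (ends G h \<inter> S = {} \<and> ends G h \<inter> T \<noteq> {}) \<and>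
      (h \<in> M0 \<longrightarrow> sum y (ends G h) = 0)" if h: "h \<in> edges G - {e, f}" for h
  proof -
    obtain a b where ab: "ends G h = {a, b}" "s a" "\<not> s b" "a \<in> verts G" "b \<in> verts G"
      using coloured_edgeE[OF h] .
    have "a \<noteq> b" "a \<notin> T" "b \<notin> S"
      using ab closed_pair_sub[OF ST] by auto
    then show ?thesis
      using closed_pairD[OF ST h ab(1,2)] ab(1) by (auto simp: y_def)
  qed
  have "(\<Sum>h\<in>M0. sum y (ends G h)) = 0"
    using y M0_sub by (intro sum.neutral) blast
  then have total: "sum y (verts G) = 0"
    using perfect_matching_sum[OF wf M0(1), of y] by simp
  have sub: "M \<subseteq> edges G"
    using M by (simp add: perfect_matching_def)
  have "(\<Sum>h\<in>M - {e, f}. sum y (ends G h)) =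
      (\<Sum>h\<in>M - {e, f}. - of_bool (ends G h \<inter> S = {} \<and> ends G h \<inter> T \<noteq> {}))"
    using y sub by (intro sum.cong) blast+
  also have "\<dots> = - int (card {h \<in> M - {e, f}. ends G h \<inter> S = {} \<and> ends G h \<inter> T \<noteq> {}})"
    by (simp add: sum_negf of_bool_def sum.If_cases Int_def)
  finally have rest: "(\<Sum>h\<in>M - {e, f}. sum y (ends G h)) =
      - int (card {h \<in> M - {e, f}. ends G h \<inter> S = {} \<and> ends G h \<inter> T \<noteq> {}})" .
  have "a1 \<noteq> a2" "b1 \<noteq> b2"
    using wf_ugraph_endsD(1)[OF wf edges(1) ends_e(1)] wf_ugraph_endsD(1)[OF wf edges(2) ends_f(1)] by auto
  moreover have "a1 \<notin> T" "a2 \<notin> T" "b1 \<notin> S" "b2 \<notin> S"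
    using closed_pair_sub[OF ST] ends_e ends_f by auto
  ultimately have ef: "sum y (ends G e) + sum y (ends G f) =
      of_bool (a1 \<in> S) + of_bool (a2 \<in> S) - of_bool (b1 \<in> T) - of_bool (b2 \<in> T)"
    using ends_e(1) ends_f(1) by (simp add: y_def)
  have "(\<Sum>h\<in>M. sum y (ends G h)) =
      (\<Sum>h\<in>M \<inter> {e, f}. sum y (ends G h)) + (\<Sum>h\<in>M - {e, f}. sum y (ends G h))"
    by (subst sum.union_disjoint[symmetric]) (auto intro: sum.cong)
  moreover have "(\<Sum>h\<in>M. sum y (ends G h)) = 0"
    using perfect_matching_sum[OF wf M, of y] total by simp
  moreover have "(\<Sum>h\<in>M \<inter> {e, f}. sum y (ends G h)) =
      (if e \<in> M then sum y (ends G e) + sum y (ends G f) else 0)"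
  proof (cases "e \<in> M")
    case True
    then have "M \<inter> {e, f} = {e, f}"
      using dep[OF M] by blast
    then show ?thesis
      using True edges(3) by simp
  next
    case False
    then have "M \<inter> {e, f} = {}"
      using dep[OF M] by blast
    then show ?thesis
      using False by simp
  qed
  ultimately have "int (card {h \<in> M - {e, f}. ends G h \<inter> S = {} \<and> ends G h \<inter> T \<noteq> {}}) =
      (if e \<in> M then sum y (ends G e) + sum y (ends G f) else 0)"
    using rest by linarith
  then show ?thesis
    unfolding ef .
qed

text \<open>Otherwise \<open>S \<union> T \<union> {c2}\<close> would be a shore of a non-trivial tight cut.\<close>

lemma not_split:
  assumes ST: "closed_pair S T"
    and e12: "{c1, c2} = {a1, a2}" "c1 \<in> S" "c2 \<notin> S" and f12: "b1 \<notin> T" "b2 \<notin> T"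
    and a: "a \<in> verts G" "s a" "a \<notin> S" "a \<noteq> c2"
  shows False
proof -
  define U where "U = insert c2 (S \<union> T)"
  have ends_c: "ends G e = {c1, c2}"
    using e12(1) ends_e(1) by simp
  note c12 = wf_ugraph_endsD[OF wf edges(1) ends_c]
  have sc2: "s c2"
    using e12(1) ends_e(2,3) by (auto simp: doubleton_eq_iff)
  have U: "U \<subseteq> verts G"
    using closed_pair_sub[OF ST] c12 by (auto simp: U_def)
  have eU: "e \<notin> cut G U"
    unfolding in_cut_iff[OF edges(1) ends_c c12(1)] using e12(2) by (simp add: U_def)
  have bU: "b1 \<notin> U" "b2 \<notin> U"
    using f12 ends_f sc2 closed_pair_sub[OF ST] by (auto simp: U_def)
  have fU: "f \<notin> cut G U"
    using in_cut_iff[OF edges(2) ends_f(1), of U] wf_ugraph_endsD(1)[OF wf edges(2) ends_f(1)] bU by blast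
  have cutU: "h \<in> cut G U \<longleftrightarrow>
      (if c2 \<in> ends G h then ends G h \<inter> T = {} else ends G h \<inter> S = {} \<and> ends G h \<inter> T \<noteq> {})"
    if h: "h \<in> edges G - {e, f}" for h
  proof -
    obtain p q where pq: "ends G h = {p, q}" "s p" "\<not> s q" "p \<in> verts G" "q \<in> verts G"
      using coloured_edgeE[OF h] .
    have ne: "p \<noteq> q" "q \<noteq> c2" "p \<notin> T" "q \<notin> S" "c2 \<notin> T"
      using pq sc2 closed_pair_sub[OF ST] by auto
    have he: "h \<in> edges G"
      using h by simp
    show ?thesis
      unfolding in_cut_iff[OF he pq(1) ne(1)]
      using closed_pairD(1)[OF ST h pq(1,2)] ne e12(3) pq(1) by (auto simp: U_def)
  qed
  \<comment> \<open>If \<open>e\<close> is in \<open>M\<close>, no other edge of \<open>M\<close>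
    meets \<open>c2\<close>, and the cut edges are the crossings into \<open>T\<close>, of which
    \<open>crossing_count\<close> leaves exactly one. Otherwise there is no crossing, and only the
    edge at \<open>c2\<close> leaves \<open>U\<close>.\<close>
  have count: "card (M \<inter> cut G U) = 1" if M: "perfect_matching G M" for M
  proof -
    let ?X = "{h \<in> M - {e, f}. ends G h \<inter> S = {} \<and> ends G h \<inter> T \<noteq> {}}"
    have sub: "M \<subseteq> edges G"
      using M by (simp add: perfect_matching_def)
    show ?thesis
    proof (cases "e \<in> M")
      case True
      have nc: "c2 \<notin> ends G h" if "h \<in> M - {e, f}" for h
        using perfect_matching_unique[OF wf M _ True, of h c2] that ends_c by auto
      have "h \<in> M \<inter> cut G U \<longleftrightarrow> h \<in> ?X" for h
      proof (cases "h \<in> M - {e, f}")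
        case hM: True
        then have "h \<in> edges G - {e, f}"
          using sub by blast
        then show ?thesis
          using cutU[of h] nc[OF hM] hM by simp
      next
        case False
        then show ?thesis
          using eU fU by blast
      qed
      then have "M \<inter> cut G U = ?X"
        by (rule set_eqI)
      moreover have "of_bool (a1 \<in> S) + of_bool (a2 \<in> S) = (1 :: int)"
        using e12 by (auto simp: doubleton_eq_iff)
      then have "int (card ?X) = 1"
        using crossing_count[OF ST M] True f12 by simp
      ultimately show ?thesis
        by simp
    next
      case False
      then have fM: "f \<notin> M"
        using dep[OF M] by simp
      obtain h where h: "h \<in> M" "c2 \<in> ends G h" "h \<in> edges G"
        using perfect_matching_edge_at[OF M c12(3)] .
      have "card ?X = 0"
        using crossing_count[OF ST M] False by simp
      then have X: "g \<notin> ?X" for g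
        by simp
      have hc: "g \<in> cut G U \<longleftrightarrow> c2 \<in> ends G g" if g: "g \<in> M" for g
      proof -
        have ge: "g \<in> edges G - {e, f}"
          using g sub False fM by auto
        obtain p q where pq: "ends G g = {p, q}" "s p" "\<not> s q" "p \<in> verts G" "q \<in> verts G"
          using coloured_edgeE[OF ge] .
        have "ends G g \<inter> S = {}" if "c2 \<in> ends G g"
        proof -
          have "p = c2"
            using that pq sc2 by auto
          then show ?thesis
            using pq e12(3) closed_pair_sub(1)[OF ST] by auto
        qed
        then show ?thesis
          using cutU[OF ge] X[of g] g False fM by auto
      qed
      have "M \<inter> cut G U = {h}"
        using h hc perfect_matching_unique[OF wf M _ h(1) _ h(2)] by blast
      then show ?thesis
        by simp
    qed
  qed
  have oddU: "odd (card U)"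
    using odd_card_matching_cut[OF wf M0(1) U] count[OF M0(1)] by simp
  have fin: "finite (verts G)" "finite U"
    using wf U by (auto simp: wf_ugraph_def intro: finite_subset)
  have "card (verts G - U) = card (verts G) - card U" "card U \<le> card (verts G)"
    using U fin by (auto intro!: card_Diff_subset card_mono)
  then have "odd (card (verts G - U))"
    using oddU matching_coveredD(2)[OF brickD(1)[OF brick]] by simp
  then have "tight_cut G U"
    using U oddU count by (simp add: tight_cut_def)
  moreover have "card {c1, c2} \<le> card U"
    using fin e12(2) by (intro card_mono) (auto simp: U_def)
  then have "card U > 1"
    using c12(1) by simp
  \<comment> \<open>The vertices \<open>a\<close> and \<open>b1\<close> keep the complementary shore
    from being trivial.\<close>
  moreover have "a \<notin> U" "a \<noteq> b1" "b1 \<in> verts G"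
    using a ends_f wf_ugraph_endsD[OF wf edges(2) ends_f(1)] closed_pair_sub(2)[OF ST, of a]
    by (auto simp: U_def)
  then have "card {a, b1} \<le> card (verts G - U)"
    using fin a(1) bU by (intro card_mono) auto
  then have "card (verts G - U) > 1"
    using \<open>a \<noteq> b1\<close> by simp
  ultimately show False
    using brickD(3)[OF brick] by (auto simp: nontrivial_tight_cut_def)
qed

text \<open>An edge of \<open>G - e - f\<close> starting outside \<open>T\<close> cannot end in
  \<open>S\<close>, and \<open>M0\<close> matches the complements of \<open>S\<close> and
  \<open>T\<close> in their colour classes as well.\<close>

lemma closed_pair_flip:
  assumes ST: "closed_pair S T"
  shows "bipartite_pair.closed_pair G f e (\<lambda>v. \<not> s v) M0
    {v \<in> verts G. \<not> s v \<and> v \<notin> T} {v \<in> verts G. s v \<and> v \<notin> S}"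
  unfolding bipartite_pair.closed_pair_def[OF flip]
proof (intro conjI ballI allI impI)
  fix h a b assume h: "h \<in> edges G - {f, e}" and ab: "ends G h = {a, b}" and a: "\<not> s a"
  have h': "h \<in> edges G - {e, f}" and ba: "ends G h = {b, a}"
    using h ab by auto
  have b: "s b" "b \<in> verts G" "a \<in> verts G"
    using col[OF h' ab] a wf_ugraph_endsD[OF wf _ ab] h by auto
  show "b \<in> {v \<in> verts G. s v \<and> v \<notin> S}" if "a \<in> {v \<in> verts G. \<not> s v \<and> v \<notin> T}"
    using closed_pairD(1)[OF ST h' ba b(1)] that b by blast
  show "a \<in> {v \<in> verts G. \<not> s v \<and> v \<notin> T}" if "h \<in> M0" "b \<in> {v \<in> verts G. s v \<and> v \<notin> S}"
    using closed_pairD(2)[OF ST h' ba b(1) that(1)] that a b by blast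
qed auto

text \<open>The edge \<open>g\<close> is a crossing, so by \<open>crossing_count\<close> the set
  \<open>S\<close> contains more ends of \<open>e\<close> than \<open>T\<close> contains ends of
  \<open>f\<close>. The possible numbers are 2 and 0, 1 and 0, or 2 and 1; \<open>not_split\<close>
  excludes the second possibility and its mirror image the third.\<close>

lemma crossing_forces:
  assumes ST: "closed_pair S T" and M: "perfect_matching G M" "g \<in> M" "g \<noteq> e" "g \<noteq> f" "e \<in> M"
    and g: "ends G g = {a, b}" "s a" "a \<notin> S" "b \<in> T"
  shows "a1 \<in> S" "a2 \<in> S" "b1 \<notin> T" "b2 \<notin> T"
proof -
  let ?X = "{h \<in> M - {e, f}. ends G h \<inter> S = {} \<and> ends G h \<inter> T \<noteq> {}}"
  have ge: "g \<in> edges G"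
    using M by (auto simp: perfect_matching_def)
  have fM: "f \<in> M"
    using dep[OF M(1)] M(5) by simp
  note ab = wf_ugraph_endsD[OF wf ge g(1)]
  have "b \<notin> S"
    using g(4) closed_pair_sub(1,2)[OF ST, of b] by blast
  then have "g \<in> ?X"
    using M g by auto
  then have "card ?X > 0"
    by (auto simp: card_gt_0_iff)
  then have pos: "0 < (of_bool (a1 \<in> S) + of_bool (a2 \<in> S) - of_bool (b1 \<in> T) - of_bool (b2 \<in> T) :: int)"
    using crossing_count[OF ST M(1)] M(5) by simp
  \<comment> \<open>\<open>M\<close> contains \<open>g\<close>, \<open>e\<close> and
    \<open>f\<close>, so their ends are disjoint. This makes \<open>a\<close> and \<open>b\<close>
    the spare vertices required by \<open>not_split\<close> and its mirror image.\<close>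
  have ne: "a \<noteq> a1" "a \<noteq> a2" "b \<noteq> b1" "b \<noteq> b2"
    using perfect_matching_unique[OF wf M(1,2,5), of a] perfect_matching_unique[OF wf M(1,2) fM, of b]
      M(3,4) g(1) ends_e(1) ends_f(1) by auto
  have eq: "{a2, a1} = {a1, a2}" "{b2, b1} = {b1, b2}"
    by auto
  note ns = bipartite_pair.not_split[OF flip closed_pair_flip[OF ST]]
  have a12: "a1 \<in> verts G" "a2 \<in> verts G" "b1 \<in> verts G" "b2 \<in> verts G"
    using wf_ugraph_endsD[OF wf edges(1) ends_e(1)] wf_ugraph_endsD[OF wf edges(2) ends_f(1)] by auto
  have b: "b \<notin> {v \<in> verts G. \<not> s v \<and> v \<notin> T}" "\<not> s b"
    using g(4) closed_pair_sub(2)[OF ST] by auto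
  have 1: False if "a1 \<in> S" "a2 \<notin> S" "b1 \<notin> T" "b2 \<notin> T"
    using not_split[OF ST refl that ab(2) g(2,3) ne(2)] .
  have 2: False if "a2 \<in> S" "a1 \<notin> S" "b1 \<notin> T" "b2 \<notin> T"
    using not_split[OF ST eq(1) that ab(2) g(2,3) ne(1)] .
  have 3: False if "a1 \<in> S" "a2 \<in> S" "b1 \<notin> T" "b2 \<in> T"
    by (rule ns[OF refl _ _ _ _ ab(3) b(2,1) ne(4)]) (use that a12 ends_f in auto)
  have 4: False if "a1 \<in> S" "a2 \<in> S" "b2 \<notin> T" "b1 \<in> T"
    by (rule ns[OF eq(2) _ _ _ _ ab(3) b(2,1) ne(3)]) (use that a12 ends_f in auto)
  show "a1 \<in> S" "a2 \<in> S" "b1 \<notin> T" "b2 \<notin> T"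
    using pos 1 2 3 4
    by (cases "a1 \<in> S"; cases "a2 \<in> S"; cases "b1 \<in> T"; cases "b2 \<in> T"; simp)+
qed

section \<open>Sets closed under alternating steps\<close>

abbreviation "step \<equiv> alternating_step G {e, f} M0 s"

text \<open>The \<open>M0\<close>-mate of a neighbour of \<open>S\<close> is one step away from
  \<open>S\<close>, hence in \<open>S\<close>; so every neighbour is a mate of a vertex in
  \<open>S\<close>.\<close>

lemma closed_pair_steps:
  assumes S: "\<And>v. v \<in> S \<Longrightarrow> s v \<and> v \<in> verts G"
    and closed: "\<And>v w. v \<in> S \<Longrightarrow> step v w \<Longrightarrow> w \<in> S"
  shows "closed_pair S {b \<in> verts G. \<exists>k\<in>M0. \<exists>a\<in>S. ends G k = {a, b}}"
  unfolding closed_pair_def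
proof (intro conjI ballI allI impI)
  fix v assume "v \<in> {b \<in> verts G. \<exists>k\<in>M0. \<exists>a\<in>S. ends G k = {a, b}}"
  then obtain k a where ka: "k \<in> M0" "a \<in> S" "ends G k = {a, v}"
    by blast
  then have "k \<in> edges G - {e, f}"
    using M0_sub by blast
  then show "\<not> s v"
    using col[OF _ ka(3)] S[OF ka(2)] by blast
next
  fix h a b assume h: "h \<in> edges G - {e, f}" and ab: "ends G h = {a, b}" and sa: "s a"
  have abV: "a \<in> verts G" "b \<in> verts G" "\<not> s b"
    using wf_ugraph_endsD[OF wf _ ab] h col[OF h ab] sa by auto
  show "b \<in> {b \<in> verts G. \<exists>k\<in>M0. \<exists>a\<in>S. ends G k = {a, b}}" if a: "a \<in> S"
  proof -
    obtain k where k: "k \<in> M0" "b \<in> ends G k" "k \<in> edges G"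
      using perfect_matching_edge_at[OF M0(1) abV(2)] .
    then have ke: "k \<in> edges G - {e, f}"
      using M0_sub by blast
    obtain p q where pq: "ends G k = {p, q}" "s p" "\<not> s q" "p \<in> verts G" "q \<in> verts G"
      using coloured_edgeE[OF ke] .
    then have kb: "ends G k = {p, b}"
      using k(2) abV(3) by auto
    then have "step a p"
      unfolding alternating_step_def using sa pq(2) h k(1) ab by blast
    then have "p \<in> S"
      using closed a by blast
    then show ?thesis
      using k(1) kb abV(2) by blast
  qed
  show "a \<in> S" if hM: "h \<in> M0" and b: "b \<in> {b \<in> verts G. \<exists>k\<in>M0. \<exists>a\<in>S. ends G k = {a, b}}"
  proof -
    obtain k a' where k: "k \<in> M0" "a' \<in> S" "ends G k = {a', b}"
      using b by blast
    have "k = h"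
      using perfect_matching_unique[OF wf M0(1) k(1) hM, of b] k(3) ab by simp
    then show ?thesis
      using k ab abV(3) sa by (auto simp: doubleton_eq_iff)
  qed
qed (use S in auto)

lemma path_vectorE:
  assumes "step\<^sup>*\<^sup>* v w"
  obtains d where "\<forall>h. h \<notin> edges G - {e, f} \<longrightarrow> d h = 0" "\<forall>h. h \<notin> M0 \<longrightarrow> d h \<ge> 0"
    "\<forall>v'. star_sum G d v' = indicator {v} v' - indicator {w} v'"
proof -
  obtain d where "(\<forall>h. h \<notin> edges G - {e, f} \<longrightarrow> d h = 0) \<and> (\<forall>h. h \<notin> M0 \<longrightarrow> d h \<ge> 0) \<and>
    (\<forall>v'. star_sum G d v' = indicator {v} v' - indicator {w} v')"
    using alternating_path_vector[OF wf M0_sub assms] ..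
  then show thesis
    by (intro that[of d]) simp_all
qed

lemma mateE:
  assumes "b \<in> verts G" "\<not> s b"
  obtains k p where "k \<in> M0" "k \<in> edges G" "ends G k = {p, b}" "s p" "p \<in> verts G"
proof -
  obtain k where k: "k \<in> M0" "b \<in> ends G k" "k \<in> edges G"
    using perfect_matching_edge_at[OF M0(1) assms(1)] .
  then have ke: "k \<in> edges G - {e, f}"
    using M0_sub by blast
  obtain p q where pq: "ends G k = {p, q}" "s p" "\<not> s q" "p \<in> verts G" "q \<in> verts G"
    using coloured_edgeE[OF ke] .
  then have "ends G k = {p, b}"
    using k(2) assms(2) by auto
  then show thesis
    using that k pq by blast
qed

lemma avoiding_matching:
  assumes g: "g \<in> edges G - {e, f}"
  shows "\<exists>M. perfect_matching G M \<and> g \<in> M \<and> e \<notin> M"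
proof (rule ccontr)
  assume neg: "\<not> ?thesis"
  have dep_g: "e \<in> M" if "perfect_matching G M" "g \<in> M" for M
    using neg that by blast
  have gM0: "g \<notin> M0"
    using dep_g[OF M0(1)] M0(2) by blast
  have ge: "g \<in> edges G" "g \<noteq> e" "g \<noteq> f"
    using g by auto
  obtain M1 where M1: "perfect_matching G M1" "g \<in> M1"
    using matching_coveredD(5)[OF brickD(1)[OF brick] ge(1)] by blast
  have eM1: "e \<in> M1"
    using dep_g[OF M1] .
  obtain a b where ab: "ends G g = {a, b}" "s a" "\<not> s b" "a \<in> verts G" "b \<in> verts G"
    using coloured_edgeE[OF g] .
  obtain k p where k: "k \<in> M0" "k \<in> edges G" "ends G k = {p, b}" "s p" "p \<in> verts G"
    using mateE[OF ab(5,3)] .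
  have b12: "b1 \<in> verts G" "b2 \<in> verts G"
    using wf_ugraph_endsD[OF wf edges(2) ends_f(1)] by auto
  obtain k1 q1 where k1: "k1 \<in> M0" "k1 \<in> edges G" "ends G k1 = {q1, b1}" "s q1" "q1 \<in> verts G"
    using mateE[OF b12(1) ends_f(2)] .
  obtain k2 q2 where k2: "k2 \<in> M0" "k2 \<in> edges G" "ends G k2 = {q2, b2}" "s q2" "q2 \<in> verts G"
    using mateE[OF b12(2) ends_f(3)] .
  note star_g = star_sum_edge[OF wf ge(1) ab(1)]
  note star_k = star_sum_edge[OF wf k(2,3)]
  have eM0: "e \<noteq> k" "e \<noteq> k1" "e \<noteq> k2" and gk: "g \<noteq> k" "g \<noteq> k1" "g \<noteq> k2"
    using M0(2) gM0 k(1) k1(1) k2(1) by auto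
  \<comment> \<open>Such a path, closed up by adding \<open>g\<close> and subtracting the mate edge
    \<open>k\<close> of \<open>b\<close>, would be a feasible direction that raises \<open>g\<close>
    and leaves \<open>e\<close> at 0.\<close>
  have not_pa: "\<not> step\<^sup>*\<^sup>* p a"
  proof
    assume path: "step\<^sup>*\<^sup>* p a"
    obtain d where "\<forall>h. h \<notin> edges G - {e, f} \<longrightarrow> d h = 0" "\<forall>h. h \<notin> M0 \<longrightarrow> d h \<ge> 0"
        "\<forall>v. star_sum G d v = indicator {p} v - indicator {a} v"
      using path_vectorE[OF path] .
    note d = this[rule_format]
    define c where "c h = d h + (indicator {g} h - indicator {k} h)" for h
    have "c g \<le> c e"
    proof (rule perturbed_matching_le[OF wf PM dep_g M0(1) gM0 M0(2)])
      show "c h = 0" if "h \<notin> edges G" for h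
        using d(1)[of h] that ge(1) k(2) by (auto simp: c_def indicator_def)
      show "c h \<ge> 0" if "h \<notin> M0" for h
        using d(2)[OF that] that k(1) by (auto simp: c_def indicator_def)
      show "star_sum G c v = 0" for v
        unfolding c_def star_sum_add star_sum_diff d(3) star_g star_k by simp
    qed
    moreover have "c e = 0" "c g \<ge> 1"
      using d(1)[of e] d(2)[OF gM0] ge(2) eM0 gk by (simp_all add: c_def)
    ultimately show False
      by simp
  qed
  \<comment> \<open>Both sets contain \<open>p\<close> and miss \<open>a\<close>, so
    \<open>g\<close> crosses both closed pairs. The first shows which vertices are reached from
    \<open>p\<close>, namely both ends of \<open>e\<close>; the second shows which vertices reach
    \<open>a\<close>, namely the mates \<open>q1\<close> and \<open>q2\<close> of the ends of
    \<open>f\<close>.\<close>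
  define S1 where "S1 = {v \<in> verts G. s v \<and> step\<^sup>*\<^sup>* p v}"
  define S2 where "S2 = {v \<in> verts G. s v \<and> \<not> step\<^sup>*\<^sup>* v a}"
  have stepV: "s w \<and> w \<in> verts G" if "step v w" for v w
  proof -
    obtain h k b where "s w" "k \<in> M0" "ends G k = {w, b}"
      using \<open>step v w\<close> unfolding alternating_step_def by blast
    moreover have "k \<in> edges G"
      using \<open>k \<in> M0\<close> M0_sub by blast
    ultimately show ?thesis
      using wf_ugraph_endsD(2)[OF wf] by blast
  qed
  have 1: "closed_pair S1 {b \<in> verts G. \<exists>k\<in>M0. \<exists>a\<in>S1. ends G k = {a, b}}"
    by (rule closed_pair_steps) (auto simp: S1_def dest: stepV intro: rtranclp.rtrancl_into_rtrancl)
  have 2: "closed_pair S2 {b \<in> verts G. \<exists>k\<in>M0. \<exists>a\<in>S2. ends G k = {a, b}}"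
    by (rule closed_pair_steps) (auto simp: S2_def dest: stepV intro: converse_rtranclp_into_rtranclp)
  have "p \<in> S1" "a \<notin> S1" "p \<in> S2" "a \<notin> S2"
    using not_pa k(4,5) by (auto simp: S1_def S2_def)
  then have bT: "b \<in> {b \<in> verts G. \<exists>k\<in>M0. \<exists>a\<in>S1. ends G k = {a, b}}"
    "b \<in> {b \<in> verts G. \<exists>k\<in>M0. \<exists>a\<in>S2. ends G k = {a, b}}"
    using ab(5) k by auto
  note f1 = crossing_forces[OF 1 M1 ge(2,3) eM1 ab(1,2) \<open>a \<notin> S1\<close> bT(1)]
  note f2 = crossing_forces[OF 2 M1 ge(2,3) eM1 ab(1,2) \<open>a \<notin> S2\<close> bT(2)]
  have paths_a: "step\<^sup>*\<^sup>* p a1" "step\<^sup>*\<^sup>* p a2"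
    using f1(1,2) by (auto simp: S1_def)
  have "q1 \<notin> S2" "q2 \<notin> S2"
    using f2(3,4) b12 k1 k2 by blast+
  then have paths_b: "step\<^sup>*\<^sup>* q1 a" "step\<^sup>*\<^sup>* q2 a"
    using k1(4,5) k2(4,5) by (auto simp: S2_def)
  obtain d1 where "\<forall>h. h \<notin> edges G - {e, f} \<longrightarrow> d1 h = 0" "\<forall>h. h \<notin> M0 \<longrightarrow> d1 h \<ge> 0"
      "\<forall>v. star_sum G d1 v = indicator {p} v - indicator {a1} v"
    using path_vectorE[OF paths_a(1)] .
  note d1 = this[rule_format]
  obtain d2 where "\<forall>h. h \<notin> edges G - {e, f} \<longrightarrow> d2 h = 0" "\<forall>h. h \<notin> M0 \<longrightarrow> d2 h \<ge> 0"
      "\<forall>v. star_sum G d2 v = indicator {p} v - indicator {a2} v"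
    using path_vectorE[OF paths_a(2)] .
  note d2 = this[rule_format]
  obtain d3 where "\<forall>h. h \<notin> edges G - {e, f} \<longrightarrow> d3 h = 0" "\<forall>h. h \<notin> M0 \<longrightarrow> d3 h \<ge> 0"
      "\<forall>v. star_sum G d3 v = indicator {q1} v - indicator {a} v"
    using path_vectorE[OF paths_b(1)] .
  note d3 = this[rule_format]
  obtain d4 where "\<forall>h. h \<notin> edges G - {e, f} \<longrightarrow> d4 h = 0" "\<forall>h. h \<notin> M0 \<longrightarrow> d4 h \<ge> 0"
      "\<forall>v. star_sum G d4 v = indicator {q2} v - indicator {a} v"
    using path_vectorE[OF paths_b(2)] .
  note d4 = this[rule_format]
  txt \<open>
    A direction leading from \<open>M0\<close> into the polytope along which \<open>g\<close> grows at least twice as fast as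
    \<open>e\<close>, although \<open>g\<close> never occurs without \<open>e\<close>.
  \<close>
  define c where "c h = (d1 h + (d2 h + (d3 h + d4 h))) +
    ((2 * indicator {g} h + (indicator {e} h + indicator {f} h)) -
     (2 * indicator {k} h + (indicator {k1} h + indicator {k2} h)))" for h
  have "c g \<le> c e"
  proof (rule perturbed_matching_le[OF wf PM dep_g M0(1) gM0 M0(2)])
    show "c h = 0" if "h \<notin> edges G" for h
    proof -
      have "h \<noteq> g" "h \<noteq> e" "h \<noteq> f" "h \<noteq> k" "h \<noteq> k1" "h \<noteq> k2"
        using that ge(1) edges k(2) k1(2) k2(2) by auto
      then show ?thesis
        using that d1(1)[of h] d2(1)[of h] d3(1)[of h] d4(1)[of h] by (simp add: c_def)
    qed
    show "c h \<ge> 0" if "h \<notin> M0" for h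
    proof -
      have "h \<noteq> k" "h \<noteq> k1" "h \<noteq> k2"
        using that k(1) k1(1) k2(1) by auto
      then show ?thesis
        using d1(2)[OF that] d2(2)[OF that] d3(2)[OF that] d4(2)[OF that]
        by (simp add: c_def add_nonneg_nonneg)
    qed
    \<comment> \<open>The paths contribute 2 at \<open>p\<close>, 1 at \<open>q1\<close> and
      \<open>q2\<close>, -1 at \<open>a1\<close> and \<open>a2\<close>, and -2 at \<open>a\<close>.
      Two copies of \<open>g\<close> and \<open>k\<close> cancel \<open>a\<close> and
      \<open>p\<close>, the edge \<open>e\<close> cancels \<open>a1\<close> and \<open>a2\<close>,
      and \<open>k1\<close>, \<open>k2\<close> cancel \<open>q1\<close>, \<open>q2\<close> while
      \<open>f\<close> restores \<open>b1\<close>, \<open>b2\<close>.\<close>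
    show "star_sum G c v = 0" for v
      unfolding c_def star_sum_add star_sum_diff star_sum_scale d1(3) d2(3) d3(3) d4(3) star_g star_k
        star_sum_edge[OF wf edges(1) ends_e(1)] star_sum_edge[OF wf edges(2) ends_f(1)]
        star_sum_edge[OF wf k1(2,3)] star_sum_edge[OF wf k2(2,3)]
      by simp
  qed
  moreover have "c e = 1"
    using d1(1)[of e] d2(1)[of e] d3(1)[of e] d4(1)[of e] ge eM0 edges(3) by (simp add: c_def)
  moreover have "c g \<ge> 2"
    using d1(2)[OF gM0] d2(2)[OF gM0] d3(2)[OF gM0] d4(2)[OF gM0] ge gk by (simp add: c_def)
  ultimately show False
    by simp
qed

end


text \<open>Reduces to the normal form. If the ends of \<open>e\<close> had different colours,
  \<open>G - f\<close> would be bipartite, and likewise with \<open>e\<close> and \<open>f\<close>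
  exchanged; neither is possible. Comparing the colour balance of a matching with both edges to one
  with neither shows that they lie in opposite classes.\<close>

lemma bipartite_pair_avoiding_matching:
  fixes G :: "('v, 'e::finite) ugraph"
  assumes G: "brick G" and PM: "PM_polytope G = P_polytope G"
    and ef: "e \<in> edges G" "f \<in> edges G" "e \<noteq> f"
    and dep: "\<And>M. perfect_matching G M \<Longrightarrow> e \<in> M \<longleftrightarrow> f \<in> M"
    and bip: "bipartite (delete_edge (delete_edge G e) f)"
    and g: "g \<in> edges G - {e, f}"
  shows "\<exists>M. perfect_matching G M \<and> g \<in> M \<and> e \<notin> M"
proof -
  note mc = brickD(1)[OF G]
  note wf = matching_coveredD(1)[OF mc]
  obtain s :: "'v \<Rightarrow> bool" where s: "\<forall>h\<in>edges (delete_edge (delete_edge G e) f).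
      \<forall>a b. ends (delete_edge (delete_edge G e) f) h = {a, b} \<longrightarrow> s a \<noteq> s b"
    using bipartiteE[OF bip] .
  have col: "s a \<noteq> s b" if "h \<in> edges G - {e, f}" "ends G h = {a, b}" for h a b
    using bspec[OF s, of h] that by simp
  obtain M0 where M0: "perfect_matching G M0" "e \<notin> M0"
    using brick_avoiding[OF G ef(1)] .
  obtain M1 where M1: "perfect_matching G M1" "e \<in> M1"
    using matching_coveredD(5)[OF mc ef(1)] by blast
  have f01: "f \<notin> M0" "f \<in> M1"
    using dep M0 M1 by blast+
  obtain a1 a2 where e: "ends G e = {a1, a2}" "a1 \<noteq> a2" "a1 \<in> verts G" "a2 \<in> verts G"
    using wf_ugraph_edgeE[OF wf ef(1)] .
  obtain b1 b2 where f: "ends G f = {b1, b2}" "b1 \<noteq> b2" "b1 \<in> verts G" "b2 \<in> verts G"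
    using wf_ugraph_edgeE[OF wf ef(2)] .
  have sa: "s a1 = s a2"
  proof (rule ccontr)
    assume neq: "s a1 \<noteq> s a2"
    have "bipartite (delete_edge G f)"
    proof (rule bipartiteI[OF wf_delete_edge[OF wf]])
      fix h a b assume "h \<in> edges (delete_edge G f)" "ends (delete_edge G f) h = {a, b}"
      then show "s a \<noteq> s b"
        using col[of h a b] neq e(1) by (cases "h = e") (auto simp: doubleton_eq_iff)
    qed
    then show False
      using delete_edge_not_bipartite[OF wf brickD(2)[OF G] ef(2) M0(1) f01(1) M1(1) f01(2)] by blast
  qed
  have sb: "s b1 = s b2"
  proof (rule ccontr)
    assume neq: "s b1 \<noteq> s b2"
    have "bipartite (delete_edge G e)"
    proof (rule bipartiteI[OF wf_delete_edge[OF wf]])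
      fix h a b assume "h \<in> edges (delete_edge G e)" "ends (delete_edge G e) h = {a, b}"
      then show "s a \<noteq> s b"
        using col[of h a b] neq f(1) by (cases "h = f") (auto simp: doubleton_eq_iff)
    qed
    then show False
      using delete_edge_not_bipartite[OF wf brickD(2)[OF G] ef(1) M0 M1] by blast
  qed
  define y :: "'v \<Rightarrow> int" where "y v = (if s v then 1 else - 1)" for v
  have y0: "sum y (ends G h) = 0" if h: "h \<in> edges G - {e, f}" for h
  proof -
    have he: "h \<in> edges G"
      using h by simp
    obtain a b where "ends G h = {a, b}" "a \<noteq> b" "a \<in> verts G" "b \<in> verts G"
      using wf_ugraph_edgeE[OF wf he] .
    then show ?thesis
      using col[OF h] by (auto simp: y_def)
  qed
  have sub: "M0 \<subseteq> edges G" "M1 \<subseteq> edges G"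
    using M0 M1 by (simp_all add: perfect_matching_def)
  have "(\<Sum>h\<in>M0. sum y (ends G h)) = 0"
    using y0 sub(1) M0(2) f01(1) by (intro sum.neutral) blast
  then have "(\<Sum>h\<in>M1. sum y (ends G h)) = 0"
    using perfect_matching_sum[OF wf M0(1), of y] perfect_matching_sum[OF wf M1(1), of y] by simp
  moreover have "(\<Sum>h\<in>M1. sum y (ends G h)) = (\<Sum>h\<in>{e, f}. sum y (ends G h))"
    using y0 sub(2) M1(2) f01(2) by (intro sum.mono_neutral_right) auto
  ultimately have "sum y (ends G e) + sum y (ends G f) = 0"
    using ef(3) by simp
  then have "s a1 \<noteq> s b1"
    using e f sa sb by (auto simp: y_def split: if_splits)
  show ?thesis
  proof (cases "s a1")
    case True
    have "bipartite_pair G e f s M0 a1 a2 b1 b2"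
      unfolding bipartite_pair_def
      using G PM ef dep col e(1) f(1) M0 True sa sb \<open>s a1 \<noteq> s b1\<close> by blast
    then show ?thesis
      using g by (rule bipartite_pair.avoiding_matching)
  next
    case False
    have "bipartite_pair G e f (\<lambda>v. \<not> s v) M0 a1 a2 b1 b2"
      unfolding bipartite_pair_def
      using G PM ef dep col e(1) f(1) M0 False sa sb \<open>s a1 \<noteq> s b1\<close> by blast
    then show ?thesis
      using g by (rule bipartite_pair.avoiding_matching)
  qed
qed

section \<open>The facet criterion\<close>

text \<open>Treats both conditions at once, with \<open>R\<close> equal to \<open>{e}\<close> or to
  \<open>{e, f}\<close>. A functional constant on the face has a potential on \<open>H\<close>. What
  remains after subtracting it lives on \<open>R\<close>, and as a matching contains all of
  \<open>R\<close> or nothing of it, the remainder is a multiple of the coordinate at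
  \<open>e\<close>.\<close>

lemma facet_of_deletion:
  fixes G H :: "('v, 'e::finite) ugraph"
  assumes G: "matching_covered G" and e: "e \<in> R" "R \<subseteq> edges G"
    and dep: "\<And>M g. perfect_matching G M \<Longrightarrow> g \<in> R \<Longrightarrow> g \<in> M \<longleftrightarrow> e \<in> M"
    and H: "wf_ugraph H" "verts H = verts G" "ends H = ends G" "edges H = edges G - R"
    and PMH: "PM_polytope H = P_polytope H"
    and HM: "\<And>M. perfect_matching H M \<longleftrightarrow> perfect_matching G M \<and> e \<notin> M"
    and cov: "\<And>g. g \<in> edges G - R \<Longrightarrow> \<exists>M. perfect_matching G M \<and> g \<in> M \<and> e \<notin> M"
    and M0: "perfect_matching G M0" "e \<notin> M0"
  shows "facet_defining (PM_polytope G) (axis e 1) 0"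
proof -
  note wf = matching_coveredD(1)[OF G]
  obtain M1 where M1: "perfect_matching G M1" "e \<in> M1"
    using matching_coveredD(5)[OF G] e by blast
  let ?i = "incidence_vector :: 'e set \<Rightarrow> real ^ 'e"
  show ?thesis
  proof (rule facet_definingI[where p = "?i M0" and q = "?i M1"])
    show "?i M0 \<in> PM_polytope G" "?i M1 \<in> PM_polytope G"
      using M0 M1 incidence_vector_in_PM by blast+
    show "axis e 1 \<bullet> ?i M0 = 0" "axis e 1 \<bullet> ?i M1 \<noteq> 0"
      using M0 M1 by (simp_all add: inner_axis')
    show "0 \<le> axis e 1 \<bullet> x" if "x \<in> PM_polytope G" for x :: "real ^ 'e"
    proof -
      have "(- axis e 1) \<bullet> x \<le> 0"
        by (rule PM_polytope_le[OF _ that]) (simp add: inner_axis' indicator_def)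
      then show ?thesis
        by simp
    qed
  next
    fix c :: "real ^ 'e" and \<gamma>
    assume c: "\<And>x. x \<in> PM_polytope G \<Longrightarrow> axis e 1 \<bullet> x = 0 \<Longrightarrow> c \<bullet> x = \<gamma>"
    have cM: "(\<Sum>g\<in>M. c $ g) = \<gamma>" if M: "perfect_matching H M" for M
    proof -
      have "perfect_matching G M" "e \<notin> M"
        using M HM by blast+
      then show ?thesis
        using c[of "?i M"] incidence_vector_in_PM[of G M]
        by (simp add: inner_axis' flip: inner_incidence_vector)
    qed
    obtain y where y: "\<forall>g\<in>edges H. c $ g = sum y (ends H g)"
    proof (rule BvN_potential[OF H(1) _ PMH cM])
      show "\<exists>M. perfect_matching H M \<and> g \<in> M" if "g \<in> edges H" for g
        using cov[of g] that H(4) HM by auto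
    qed
    have M0sum: "sum y (verts G) = \<gamma>"
    proof -
      have HM0: "perfect_matching H M0"
        using M0 HM by blast
      then have "M0 \<subseteq> edges H"
        by (simp add: perfect_matching_def)
      then have "(\<Sum>g\<in>M0. c $ g) = (\<Sum>g\<in>M0. sum y (ends G g))"
        using y H(3) by (intro sum.cong) auto
      then show ?thesis
        using perfect_matching_sum[OF wf M0(1), of y] cM[OF HM0] by simp
    qed
    \<comment> \<open>The multiple is the total deviation of \<open>c\<close> from the potential
      over \<open>R\<close>.\<close>
    define l where "l = (\<Sum>g\<in>R. c $ g - sum y (ends G g))"
    have "(c - l *\<^sub>R axis e 1) \<bullet> x = \<gamma>" if x: "x \<in> PM_polytope G" for x
    proof (rule PM_polytope_eq[OF _ x])
      fix M assume M: "perfect_matching G M"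
      have sub: "M \<subseteq> edges G"
        using M by (simp add: perfect_matching_def)
      have "(\<Sum>g\<in>M. c $ g) - \<gamma> = (\<Sum>g\<in>M. c $ g - sum y (ends G g))"
        using perfect_matching_sum[OF wf M, of y] M0sum by (simp add: sum_subtractf)
      also have "\<dots> = (\<Sum>g\<in>M \<inter> R. c $ g - sum y (ends G g))"
        using y sub H(3,4) by (intro sum.mono_neutral_right) auto
      also have "\<dots> = l * indicator M e"
      proof (cases "e \<in> M")
        case True
        then have "M \<inter> R = R"
          using dep[OF M] by blast
        then show ?thesis
          using True by (simp add: l_def)
      next
        case False
        then have "M \<inter> R = {}"
          using dep[OF M] by blast
        then show ?thesis
          using False by simp
      qed
      finally show "(c - l *\<^sub>R axis e 1) \<bullet> ?i M = \<gamma>"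
        by (simp add: inner_diff_left inner_axis' inner_incidence_vector[of c])
    qed
    then show "\<exists>l. \<forall>x\<in>PM_polytope G. c \<bullet> x - \<gamma> = l * (axis e 1 \<bullet> x - 0)"
      by (intro exI[of _ l]) (force simp: inner_diff_left)
  qed
qed

text \<open>Connectivity is the point to check: if \<open>e\<close> alone formed a cut, a matching
  with \<open>e\<close> would make the shore odd and \<open>M0\<close> would make it even.\<close>

lemma delete_edge_matching_covered:
  assumes G: "matching_covered G" and e: "e \<in> edges G"
    and M0: "perfect_matching G M0" "e \<notin> M0"
    and cov: "\<And>g. g \<in> edges G \<Longrightarrow> g \<noteq> e \<Longrightarrow> \<exists>M. perfect_matching G M \<and> g \<in> M \<and> e \<notin> M"
  shows "matching_covered (delete_edge G e)"
  unfolding matching_covered_def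
proof (intro conjI ballI)
  note wf = matching_coveredD(1)[OF G]
  show wf': "wf_ugraph (delete_edge G e)"
    by (rule wf_delete_edge[OF wf])
  show "even (card (verts (delete_edge G e)))"
    using matching_coveredD(2)[OF G] by simp
  obtain a b where ab: "ends G e = {a, b}" "a \<noteq> b" "a \<in> verts G" "b \<in> verts G"
    using wf_ugraph_edgeE[OF wf e] .
  show "edges (delete_edge G e) \<noteq> {}"
    using perfect_matching_edge_at[OF M0(1) ab(3)] M0(2) by auto
  show "connected_ugraph (delete_edge G e)"
    unfolding connected_ugraph_iff_cut[OF wf']
  proof (intro allI impI)
    fix K assume K: "K \<subseteq> verts (delete_edge G e) \<and> K \<noteq> {} \<and> K \<noteq> verts (delete_edge G e)"
    have cut': "cut (delete_edge G e) K = cut G K - {e}"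
      by (auto simp: cut_def)
    show "cut (delete_edge G e) K \<noteq> {}"
    proof
      assume "cut (delete_edge G e) K = {}"
      moreover have "cut G K \<noteq> {}"
        using iffD1[OF connected_ugraph_iff_cut[OF wf] matching_coveredD(3)[OF G], rule_format, of K] K
        by simp
      ultimately have cutK: "cut G K = {e}"
        using cut' by blast
      have KV: "K \<subseteq> verts G"
        using K by simp
      obtain M1 where M1: "perfect_matching G M1" "e \<in> M1"
        using matching_coveredD(5)[OF G e] by blast
      have "odd (card K)"
        using odd_card_matching_cut[OF wf M1(1) KV] cutK M1(2) by simp
      moreover have "even (card K)"
        using odd_card_matching_cut[OF wf M0(1) KV] cutK M0(2) by simp
      ultimately show False
        by blast
    qed
  qed
  show "\<exists>M. perfect_matching (delete_edge G e) M \<and> g \<in> M" if "g \<in> edges (delete_edge G e)" for g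
    using cov[of g] that by (auto simp: perfect_matching_delete_edge)
qed

lemma PM_polytope_coordinates_eq_iff:
  "(\<forall>x\<in>PM_polytope G. x $ e = x $ f) \<longleftrightarrow> (\<forall>M. perfect_matching G M \<longrightarrow> (e \<in> M \<longleftrightarrow> f \<in> M))"
proof
  assume eq: "\<forall>x\<in>PM_polytope G. x $ e = x $ f"
  show "\<forall>M. perfect_matching G M \<longrightarrow> (e \<in> M \<longleftrightarrow> f \<in> M)"
  proof (intro allI impI)
    fix M assume "perfect_matching G M"
    then have "indicator M e = (indicator M f :: real)"
      using bspec[OF eq incidence_vector_in_PM] by simp
    then show "e \<in> M \<longleftrightarrow> f \<in> M"
      by (cases "e \<in> M"; cases "f \<in> M") simp_all
  qed
next
  assume dep: "\<forall>M. perfect_matching G M \<longrightarrow> (e \<in> M \<longleftrightarrow> f \<in> M)"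
  show "\<forall>x\<in>PM_polytope G. x $ e = x $ f"
  proof
    fix x assume x: "x \<in> PM_polytope G"
    have "(axis e 1 - axis f 1) \<bullet> x = 0"
      by (rule PM_polytope_eq[OF _ x]) (use dep in \<open>simp add: inner_diff_left inner_axis' indicator_def\<close>)
    then show "x $ e = x $ f"
      by (simp add: inner_diff_left inner_axis')
  qed
qed

theorem theoremA4:
  fixes G :: "('v, 'e::finite) ugraph" and e :: 'e
  assumes "BvN G" and "brick G" and "e \<in> edges G"
  shows "facet_defining (PM_polytope G) (axis e 1) 0 \<longleftrightarrow>
      ((matching_covered (delete_edge G e) \<and> near_brick (delete_edge G e)) \<or>
       (\<exists>!e'. e' \<in> edges G \<and> e' \<noteq> e \<and> bipartite (delete_edge (delete_edge G e) e') \<and>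
          (\<forall>x \<in> PM_polytope G. x $ e = x $ e')))"
proof -
  note mc = brickD(1)[OF assms(2)]
  note wf = matching_coveredD(1)[OF mc]
  have PM: "PM_polytope G = P_polytope G"
    using assms(1) by (simp add: BvN_def)
  obtain M0 where M0: "perfect_matching G M0" "e \<notin> M0"
    using brick_avoiding[OF assms(2,3)] .
  obtain M1 where M1: "perfect_matching G M1" "e \<in> M1"
    using matching_coveredD(5)[OF mc assms(3)] by blast
  show ?thesis
    unfolding PM_polytope_coordinates_eq_iff
  proof (intro iffI; (elim disjE)?)
    assume facet: "facet_defining (PM_polytope G) (axis e 1) 0"
    show "(matching_covered (delete_edge G e) \<and> near_brick (delete_edge G e)) \<or>
       (\<exists>!e'. e' \<in> edges G \<and> e' \<noteq> e \<and> bipartite (delete_edge (delete_edge G e) e') \<and>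
          (\<forall>M. perfect_matching G M \<longrightarrow> (e \<in> M \<longleftrightarrow> e' \<in> M)))"
    proof (cases "\<forall>g\<in>edges G. g \<noteq> e \<longrightarrow> (\<exists>M. perfect_matching G M \<and> g \<in> M \<and> e \<notin> M)")
      case True
      have mc': "matching_covered (delete_edge G e)"
        by (rule delete_edge_matching_covered[OF mc assms(3) M0]) (use True in blast)
      moreover have "near_brick (delete_edge G e)"
        using mc' delete_edge_not_bipartite[OF wf brickD(2)[OF assms(2)] assms(3) M0 M1]
          PM_eq_P_delete_edge[OF wf PM] by (rule near_brickI)
      ultimately show ?thesis
        by blast
    next
      case False
      then obtain f where f: "f \<in> edges G" "f \<noteq> e"
        and fe: "\<And>M. perfect_matching G M \<Longrightarrow> f \<in> M \<Longrightarrow> e \<in> M"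
        by blast
      obtain M2 where M2: "perfect_matching G M2" "f \<in> M2"
        using matching_coveredD(5)[OF mc f(1)] by blast
      have dep: "e \<in> M \<longleftrightarrow> f \<in> M" if M: "perfect_matching G M" for M
        using fe[OF M] facet_defining_coordinate_eq[OF facet fe M0 M2 M] by blast
      have "bipartite (delete_edge (delete_edge G e) f)"
        by (rule equivalent_edges_bipartite[OF assms(2) PM assms(3) f(1) f(2)[symmetric] dep])
      moreover have "f' = f" if f': "f' \<in> edges G" "f' \<noteq> e"
        and dep': "\<forall>M. perfect_matching G M \<longrightarrow> (e \<in> M \<longleftrightarrow> f' \<in> M)" for f'
        by (rule equivalent_edge_unique[OF assms(2) PM assms(3) f'(1) f'(2)[symmetric] f(1) f(2)[symmetric] _ dep])
          (use dep' in blast)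
      ultimately show ?thesis
        using f dep by blast
    qed
  next
    assume a: "matching_covered (delete_edge G e) \<and> near_brick (delete_edge G e)"
    show "facet_defining (PM_polytope G) (axis e 1) 0"
    proof (rule facet_of_deletion[OF mc _ _ _ wf_delete_edge[OF wf] _ _ _ PM_eq_P_delete_edge[OF wf PM] _ _ M0,
          where R = "{e}"])
      \<comment> \<open>A perfect matching of \<open>G - e\<close> is one of \<open>G\<close> that
        avoids \<open>e\<close>.\<close>
      show "\<exists>M. perfect_matching G M \<and> g \<in> M \<and> e \<notin> M" if "g \<in> edges G - {e}" for g
        using a that matching_coveredD(5)[of "delete_edge G e" g]
        by (auto simp: perfect_matching_delete_edge)
    qed (use assms(3) in \<open>auto simp: perfect_matching_delete_edge\<close>)
  next
    assume "\<exists>!e'. e' \<in> edges G \<and> e' \<noteq> e \<and> bipartite (delete_edge (delete_edge G e) e') \<and>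
          (\<forall>M. perfect_matching G M \<longrightarrow> (e \<in> M \<longleftrightarrow> e' \<in> M))"
    then obtain f where f: "f \<in> edges G" "f \<noteq> e" "bipartite (delete_edge (delete_edge G e) f)"
      and dep: "\<And>M. perfect_matching G M \<Longrightarrow> e \<in> M \<longleftrightarrow> f \<in> M"
      by blast
    show "facet_defining (PM_polytope G) (axis e 1) 0"
    proof (rule facet_of_deletion[OF mc _ _ _ wf_delete_edge[OF wf_delete_edge[OF wf]] _ _ _
          PM_eq_P_delete_edge[OF wf_delete_edge[OF wf] PM_eq_P_delete_edge[OF wf PM]] _ _ M0,
          where R = "{e, f}"])
      show "\<exists>M. perfect_matching G M \<and> g \<in> M \<and> e \<notin> M" if "g \<in> edges G - {e, f}" for g
        by (rule bipartite_pair_avoiding_matching[OF assms(2) PM assms(3) f(1) f(2)[symmetric] dep f(3) that])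
      show "perfect_matching (delete_edge (delete_edge G e) f) M \<longleftrightarrow> perfect_matching G M \<and> e \<notin> M" for M
        using dep by (auto simp: perfect_matching_delete_edge)
    qed (use assms(3) f dep in auto)
  qed
qed

end
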